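(* Let $K$ be a perfect field, $V$ a finite-dimensional $K$-vector space, $d\ge 1$ an integer, and let $v\in D^dV\subseteq V^{\otimes d}$ be a symmetric tensor. Then $v$ is $\mathrm{SL}(V)^d$-semistable if and only if $v$ is $\mathrm{SL}(V)$-semistable.
   Context: $D^dV\subseteq V^{\otimes d}$ is the subspace of tensors invariant under the symmetric group $S_d$ permuting the tensor factors. The group $\mathrm{SL}(V)^d$ acts on $V^{\otimes d}$ factorwise, and $\mathrm{SL}(V)$ acts through the diagonal embedding $\mathrm{SL}(V)\hookrightarrow\mathrm{SL}(V)^d$. A 1-parameter subgroup of an algebraic group $H$ over $K$ is a homomorphism of algebraic groups $\lambda:\mathbb G_m\to H$ over $K$. For $H=\mathrm{SL}(V)^d$ or $H=\mathrm{SL}(V)$, a tensor $v$ is $H$-unstable if there is a 1-parameter subgroup $\lambda:\mathbb G_m\to H$ with $\lim_{t\to0}\lambda(t)\cdot v=0$ (i.e. the morphism $t\mapsto\lambda(t)\cdot v$ extends to $\mathbb A^1$ with value $0$ at $t=0$); otherwise $v$ is $H$-semistable. *)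

theory Defs
  imports
    "Jordan_Normal_Form.Determinant"
    "HOL-Computational_Algebra.Polynomial"
    "HOL-Combinatorics.Permutations"
    "HOL-Library.FuncSet"
    "HOL-Library.Poly_Mapping"
    "HOL-Library.Product_Plus"
begin

definition perfect_field :: "'k::field itself \<Rightarrow> bool" where
  "perfect_field _ \<longleftrightarrow> CHAR('k) = 0 \<or> surj (\<lambda>x::'k. x ^ CHAR('k))"


section \<open>Tensor powers\<close>

text \<open>
  The space \<open>V\<close> is \<open>R\<^sup>n\<close>, and \<open>V\<^sup>\<otimes>\<^sup>d\<close> is given by coordinates: the multi-index \<open>i\<close> in
  \<open>tensor_index d n\<close> stands for the basis tensor whose factor in position \<open>k < d\<close> is the unit
  vector number \<open>i k\<close>. The lemma \<open>tensors_universal\<close> below is the universal property of this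
  model with respect to the multilinear map \<open>pure_tensor\<close>.
  The coefficients range over a commutative ring \<open>R\<close>, which allows base change.
\<close>

definition tensor_index :: "nat \<Rightarrow> nat \<Rightarrow> (nat \<Rightarrow> nat) set" where
  "tensor_index d n = (\<Pi>\<^sub>E k\<in>{..<d}. {..<n})"

definition tensors :: "nat \<Rightarrow> nat \<Rightarrow> ((nat \<Rightarrow> nat) \<Rightarrow> 'r::zero) set" where
  "tensors d n = {v. \<forall>i. i \<notin> tensor_index d n \<longrightarrow> v i = 0}"

definition pure_tensor ::
    "nat \<Rightarrow> nat \<Rightarrow> (nat \<Rightarrow> 'r::comm_ring_1 vec) \<Rightarrow> (nat \<Rightarrow> nat) \<Rightarrow> 'r" where
  "pure_tensor d n u = (\<lambda>i. if i \<in> tensor_index d n then \<Prod>k<d. u k $ i k else 0)"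

text \<open>
  On pure tensors, \<open>permute_tensor \<sigma>\<close> moves the factor in position \<open>k\<close> to position \<open>\<sigma> k\<close>;
  see \<open>permute_pure_tensor\<close>.
\<close>

definition permute_tensor ::
    "(nat \<Rightarrow> nat) \<Rightarrow> ((nat \<Rightarrow> nat) \<Rightarrow> 'r) \<Rightarrow> (nat \<Rightarrow> nat) \<Rightarrow> 'r" where
  "permute_tensor \<sigma> v = (\<lambda>i. v (i \<circ> \<sigma>))"

definition symmetric_tensors :: "nat \<Rightarrow> nat \<Rightarrow> ((nat \<Rightarrow> nat) \<Rightarrow> 'r::zero) set" where
  "symmetric_tensors d n =
     {v \<in> tensors d n. \<forall>\<sigma>. \<sigma> permutes {..<d} \<longrightarrow> permute_tensor \<sigma> v = v}"

text \<open>The tensor product of the endomorphisms \<open>g 0, \<dots>, g (d - 1)\<close>; see \<open>tensor_act_pure_tensor\<close>.\<close>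

definition tensor_act ::
    "nat \<Rightarrow> nat \<Rightarrow> (nat \<Rightarrow> 'r::comm_ring_1 mat) \<Rightarrow> ((nat \<Rightarrow> nat) \<Rightarrow> 'r) \<Rightarrow> (nat \<Rightarrow> nat) \<Rightarrow> 'r" where
  "tensor_act d n g v =
     (\<lambda>i. if i \<in> tensor_index d n
          then \<Sum>j\<in>tensor_index d n. (\<Prod>k<d. g k $$ (i k, j k)) * v j else 0)"


section \<open>One-parameter subgroups\<close>

text \<open>
  \<open>K[t, t\<^sup>-\<^sup>1]\<close> and \<open>K[s, s\<^sup>-\<^sup>1, t, t\<^sup>-\<^sup>1]\<close> are the monoid algebras of \<open>\<int>\<close> and \<open>\<int> \<times> \<int>\<close>, the
  coordinate rings of \<open>\<G>\<^sub>m\<close> and \<open>\<G>\<^sub>m \<times> \<G>\<^sub>m\<close>. A morphism from \<open>\<G>\<^sub>m\<close> to an affine scheme \<open>X\<close>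
  over \<open>K\<close> is a point of \<open>X\<close> over \<open>K[t, t\<^sup>-\<^sup>1]\<close>. This is the scheme-theoretic notion; for finite
  \<open>K\<close> it would not do to look at the maps induced on \<open>K\<close>-rational points.
\<close>

type_synonym 'k laurent = "int \<Rightarrow>\<^sub>0 'k"
type_synonym 'k laurent2 = "(int \<times> int) \<Rightarrow>\<^sub>0 'k"

text \<open>The algebra homomorphism induced by a homomorphism of exponents.\<close>

definition map_exponents :: "('a \<Rightarrow> 'b) \<Rightarrow> ('a \<Rightarrow>\<^sub>0 'k::comm_monoid_add) \<Rightarrow> ('b \<Rightarrow>\<^sub>0 'k)" where
  "map_exponents f p =
     (\<Sum>e\<in>Poly_Mapping.keys p. Poly_Mapping.single (f e) (Poly_Mapping.lookup p e))"

text \<open>The substitutions \<open>t := s * t\<close>, \<open>t := s\<close> and \<open>t := t\<close>.\<close>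

definition at_st :: "'k::comm_monoid_add laurent \<Rightarrow> 'k laurent2" where
  "at_st = map_exponents (\<lambda>e. (e, e))"

definition at_s :: "'k::comm_monoid_add laurent \<Rightarrow> 'k laurent2" where
  "at_s = map_exponents (\<lambda>e. (e, 0))"

definition at_t :: "'k::comm_monoid_add laurent \<Rightarrow> 'k laurent2" where
  "at_t = map_exponents (\<lambda>e. (0, e))"

definition SL :: "nat \<Rightarrow> 'r::comm_ring_1 mat set" where
  "SL n = {A \<in> carrier_mat n n. det A = 1}"

definition one_psg_SL :: "nat \<Rightarrow> 'k::field laurent mat \<Rightarrow> bool" where
  "one_psg_SL n g \<longleftrightarrow>
     g \<in> SL n \<and> map_mat at_st g = map_mat at_s g * map_mat at_t g"

text \<open>A homomorphism into the product group is a tuple of homomorphisms into the factors.\<close>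

definition one_psg_SL_pow :: "nat \<Rightarrow> nat \<Rightarrow> (nat \<Rightarrow> 'k::field laurent mat) \<Rightarrow> bool" where
  "one_psg_SL_pow d n g \<longleftrightarrow> (\<forall>k<d. one_psg_SL n (g k))"


section \<open>Limits and semistability\<close>

definition laurent_of_poly :: "'k::field poly \<Rightarrow> 'k laurent" where
  "laurent_of_poly p = (\<Sum>j\<le>degree p. Poly_Mapping.single (int j) (coeff p j))"

definition const_tensor :: "((nat \<Rightarrow> nat) \<Rightarrow> 'k::field) \<Rightarrow> (nat \<Rightarrow> nat) \<Rightarrow> 'k laurent" where
  "const_tensor v = (\<lambda>i. Poly_Mapping.single 0 (v i))"

text \<open>
  \<open>has_limit_at_0 d n f w\<close>: the morphism \<open>f\<close> from \<open>\<G>\<^sub>m\<close> to the space of tensors extends to a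
  morphism from \<open>\<A>\<^sup>1\<close>, with value \<open>w\<close> at \<open>0\<close>.
\<close>

definition has_limit_at_0 ::
    "nat \<Rightarrow> nat \<Rightarrow> ((nat \<Rightarrow> nat) \<Rightarrow> 'k::field laurent) \<Rightarrow> ((nat \<Rightarrow> nat) \<Rightarrow> 'k) \<Rightarrow> bool" where
  "has_limit_at_0 d n f w \<longleftrightarrow>
     (\<exists>F :: (nat \<Rightarrow> nat) \<Rightarrow> 'k poly. F \<in> tensors d n \<and>
        (\<forall>i. f i = laurent_of_poly (F i)) \<and> (\<forall>i. poly (F i) 0 = w i))"

definition SL_pow_unstable :: "nat \<Rightarrow> nat \<Rightarrow> ((nat \<Rightarrow> nat) \<Rightarrow> 'k::field) \<Rightarrow> bool" where
  "SL_pow_unstable d n v \<longleftrightarrow>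
     (\<exists>g. one_psg_SL_pow d n g \<and>
        has_limit_at_0 d n (tensor_act d n g (const_tensor v)) (\<lambda>_. 0))"

definition SL_unstable :: "nat \<Rightarrow> nat \<Rightarrow> ((nat \<Rightarrow> nat) \<Rightarrow> 'k::field) \<Rightarrow> bool" where
  "SL_unstable d n v \<longleftrightarrow>
     (\<exists>g. one_psg_SL n g \<and>
        has_limit_at_0 d n (tensor_act d n (\<lambda>_. g) (const_tensor v)) (\<lambda>_. 0))"

definition SL_pow_semistable :: "nat \<Rightarrow> nat \<Rightarrow> ((nat \<Rightarrow> nat) \<Rightarrow> 'k::field) \<Rightarrow> bool" where
  "SL_pow_semistable d n v \<longleftrightarrow> \<not> SL_pow_unstable d n v"

definition SL_semistable :: "nat \<Rightarrow> nat \<Rightarrow> ((nat \<Rightarrow> nat) \<Rightarrow> 'k::field) \<Rightarrow> bool" where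
  "SL_semistable d n v \<longleftrightarrow> \<not> SL_unstable d n v"


section \<open>Adequacy of the tensor model\<close>

lemma finite_tensor_index [simp]: "finite (tensor_index d n)"
  by (simp add: tensor_index_def finite_PiE)

lemma comp_permutes_tensor_index:
  assumes "\<sigma> permutes {..<d}"
  shows "i \<circ> \<sigma> \<in> tensor_index d n \<longleftrightarrow> i \<in> tensor_index d n"
proof -
  have fwd: "i \<circ> \<sigma> \<in> tensor_index d n"
    if "i \<in> tensor_index d n" "\<sigma> permutes {..<d}" for i :: "nat \<Rightarrow> nat" and \<sigma>
    using that by (auto simp: tensor_index_def PiE_iff extensional_def permutes_not_in
        dest: permutes_in_image)
  have "i = (i \<circ> \<sigma>) \<circ> inv_into UNIV \<sigma>"
    using assms by (simp add: comp_assoc permutes_inv_o)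
  then show ?thesis
    using fwd[of i \<sigma>] fwd[of "i \<circ> \<sigma>" "inv_into UNIV \<sigma>"] assms permutes_inv by metis
qed

lemma permute_pure_tensor:
  assumes "\<sigma> permutes {..<d}"
  shows "permute_tensor \<sigma> (pure_tensor d n (u \<circ> \<sigma>)) = pure_tensor d n u"
proof
  fix i
  have "(\<Prod>k<d. u (\<sigma> k) $ i (\<sigma> k)) = (\<Prod>k<d. u k $ i k)"
    using prod.permute[OF assms, of "\<lambda>k. u k $ i k"] by (simp add: o_def)
  then show "permute_tensor \<sigma> (pure_tensor d n (u \<circ> \<sigma>)) i = pure_tensor d n u i"
    unfolding permute_tensor_def pure_tensor_def comp_permutes_tensor_index[OF assms] by simp
qed

lemma tensor_act_pure_tensor:
  assumes g: "\<And>k. k < d \<Longrightarrow> g k \<in> carrier_mat n n"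
    and u: "\<And>k. k < d \<Longrightarrow> u k \<in> carrier_vec n"
  shows "tensor_act d n g (pure_tensor d n u) = pure_tensor d n (\<lambda>k. g k *\<^sub>v u k)"
proof
  fix i
  show "tensor_act d n g (pure_tensor d n u) i = pure_tensor d n (\<lambda>k. g k *\<^sub>v u k) i"
  proof (cases "i \<in> tensor_index d n")
    case True
    then have i: "i k < n" if "k < d" for k
      using that by (auto simp: tensor_index_def PiE_iff)
    have "(g k *\<^sub>v u k) $ i k = (\<Sum>l<n. g k $$ (i k, l) * u k $ l)" if "k < d" for k
      using g[OF that] u[OF that] i[OF that]
      by (auto simp: scalar_prod_def lessThan_atLeast0 intro!: sum.cong)
    then have "(\<Prod>k<d. (g k *\<^sub>v u k) $ i k) = (\<Prod>k<d. \<Sum>l<n. g k $$ (i k, l) * u k $ l)"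
      by simp
    also have "\<dots> = (\<Sum>j\<in>tensor_index d n. \<Prod>k<d. g k $$ (i k, j k) * u k $ j k)"
      unfolding tensor_index_def by (rule prod_sum_PiE) auto
    finally show ?thesis
      using True by (simp add: tensor_act_def pure_tensor_def prod.distrib)
  qed (simp add: tensor_act_def pure_tensor_def)
qed

definition tensor_linear ::
    "nat \<Rightarrow> nat \<Rightarrow> ('k::field \<Rightarrow> 'w::ab_group_add \<Rightarrow> 'w) \<Rightarrow> (((nat \<Rightarrow> nat) \<Rightarrow> 'k) \<Rightarrow> 'w) \<Rightarrow> bool" where
  "tensor_linear d n scale F \<longleftrightarrow>
     (\<forall>v\<in>tensors d n. \<forall>w\<in>tensors d n. F (\<lambda>i. v i + w i) = F v + F w) \<and>
     (\<forall>c. \<forall>v\<in>tensors d n. F (\<lambda>i. c * v i) = scale c (F v))"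

definition multilinear ::
    "nat \<Rightarrow> nat \<Rightarrow> ('k::field \<Rightarrow> 'w::ab_group_add \<Rightarrow> 'w) \<Rightarrow> ((nat \<Rightarrow> 'k vec) \<Rightarrow> 'w) \<Rightarrow> bool" where
  "multilinear d n scale f \<longleftrightarrow>
     (\<forall>u u'. (\<forall>k<d. u k = u' k) \<longrightarrow> f u = f u') \<and>
     (\<forall>u. (\<forall>k<d. u k \<in> carrier_vec n) \<longrightarrow>
        (\<forall>k<d. \<forall>x\<in>carrier_vec n. \<forall>y\<in>carrier_vec n.
           f (u(k := x + y)) = f (u(k := x)) + f (u(k := y))) \<and>
        (\<forall>k<d. \<forall>c. \<forall>x\<in>carrier_vec n. f (u(k := c \<cdot>\<^sub>v x)) = scale c (f (u(k := x)))))"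

lemma tensors_pure_tensor: "pure_tensor d n u \<in> tensors d n"
  by (simp add: tensors_def pure_tensor_def)

lemma multilinear_expand_slot:
  fixes scale :: "'k::field \<Rightarrow> 'w::ab_group_add \<Rightarrow> 'w"
  assumes "vector_space scale" and f: "multilinear d n scale f"
    and u: "\<And>k. k < d \<Longrightarrow> u k \<in> carrier_vec n" and k: "k < d" and x: "x \<in> carrier_vec n"
  shows "f (u(k := x)) = (\<Sum>l<n. scale (x $ l) (f (u(k := unit_vec n l))))"
proof -
  interpret vector_space scale by fact
  define h where "h a = f (u(k := a))" for a
  have hadd: "h (a + b) = h a + h b" if "a \<in> carrier_vec n" "b \<in> carrier_vec n" for a b
    using f u k that unfolding multilinear_def h_def by blast
  have hsm: "h (c \<cdot>\<^sub>v a) = scale c (h a)" if "a \<in> carrier_vec n" for c a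
    using f u k that unfolding multilinear_def h_def by blast
  define P where "P m = vec n (\<lambda>l. if l < m then x $ l else 0)" for m
  have P: "P m \<in> carrier_vec n" for m by (simp add: P_def)
  have "h (P m) = (\<Sum>l<m. scale (x $ l) (h (unit_vec n l)))" if "m \<le> n" for m
    using that
  proof (induction m)
    case 0
    have "P 0 = 0 \<cdot>\<^sub>v 0\<^sub>v n" by (auto simp: P_def)
    then have "h (P 0) = 0"
      by (simp only: hsm zero_carrier_vec scale_zero_left)
    then show ?case by simp
  next
    case (Suc m)
    have "P (Suc m) = P m + x $ m \<cdot>\<^sub>v unit_vec n m"
      using Suc.prems by (auto simp: P_def less_Suc_eq)
    then show ?case using Suc by (simp add: hadd hsm P)
  qed
  moreover have "P n = x" using x by (auto simp: P_def)
  ultimately show ?thesis unfolding h_def by (metis order_refl)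
qed

lemma multilinear_expand:
  fixes scale :: "'k::field \<Rightarrow> 'w::ab_group_add \<Rightarrow> 'w"
  assumes vs: "vector_space scale" and f: "multilinear d n scale f"
    and u: "\<And>k. k < d \<Longrightarrow> u k \<in> carrier_vec n"
  shows "f u = (\<Sum>i\<in>tensor_index d n. scale (\<Prod>k<d. u k $ i k) (f (\<lambda>k. unit_vec n (i k))))"
proof -
  interpret vector_space scale by fact
  have floc: "f a = f b" if "\<And>k. k < d \<Longrightarrow> a k = b k" for a b
    using f that unfolding multilinear_def by blast
  define U where "U m i = (\<lambda>k. if k < m then unit_vec n (i k) else u k)" for m and i :: "nat \<Rightarrow> nat"
  have "f u = (\<Sum>i\<in>tensor_index m n. scale (\<Prod>k<m. u k $ i k) (f (U m i)))" if "m \<le> d" for m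
    using that
  proof (induction m)
    case 0
    then show ?case by (simp add: tensor_index_def U_def)
  next
    case (Suc m)
    then have m: "m < d" by simp
    have Uc: "U m i k \<in> carrier_vec n" if "k < d" for i k
      using u that by (simp add: U_def)
    have step: "scale (\<Prod>k<m. u k $ i k) (f (U m i)) =
        (\<Sum>l<n. scale (\<Prod>k<Suc m. u k $ (i(m := l)) k) (f (U (Suc m) (i(m := l)))))" for i
    proof -
      have "(U m i)(m := unit_vec n l) = U (Suc m) (i(m := l))" for l
        by (auto simp: U_def fun_eq_iff less_Suc_eq)
      moreover have "(U m i)(m := u m) = U m i" by (auto simp: U_def)
      ultimately have "f (U m i) = (\<Sum>l<n. scale (u m $ l) (f (U (Suc m) (i(m := l)))))"
        using multilinear_expand_slot[OF vs f, of "U m i", OF Uc m u[OF m]] by simp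
      then show ?thesis
        by (simp add: scale_sum_right)
    qed
    have eq: "tensor_index (Suc m) n = (\<lambda>(l, i). i(m := l)) ` ({..<n} \<times> tensor_index m n)"
      by (simp add: tensor_index_def lessThan_Suc PiE_insert_eq)
    have inj: "inj_on (\<lambda>(l, i). i(m := l)) ({..<n} \<times> tensor_index m n)"
      unfolding tensor_index_def by (rule inj_combinator) simp
    have "f u = (\<Sum>i\<in>tensor_index m n. scale (\<Prod>k<m. u k $ i k) (f (U m i)))"
      using Suc by simp
    also have "\<dots> = (\<Sum>i\<in>tensor_index m n. \<Sum>l<n.
        scale (\<Prod>k<Suc m. u k $ (i(m := l)) k) (f (U (Suc m) (i(m := l)))))"
      by (simp only: step)
    also have "\<dots> = (\<Sum>i\<in>tensor_index (Suc m) n.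
        scale (\<Prod>k<Suc m. u k $ i k) (f (U (Suc m) i)))"
      unfolding eq sum.reindex[OF inj] by (subst sum.swap) (simp add: sum.cartesian_product split_def)
    finally show ?case .
  qed
  from this[of d] have "f u = (\<Sum>i\<in>tensor_index d n. scale (\<Prod>k<d. u k $ i k) (f (U d i)))"
    by simp
  moreover have "f (U d i) = f (\<lambda>k. unit_vec n (i k))" for i
    by (rule floc) (simp add: U_def)
  ultimately show ?thesis by simp
qed

lemma multilinear_pure_tensor:
  fixes F :: "((nat \<Rightarrow> nat) \<Rightarrow> 'k::field) \<Rightarrow> 'w::ab_group_add"
  assumes "tensor_linear d n scale F"
  shows "multilinear d n scale (\<lambda>u. F (pure_tensor d n u))"
proof -
  have upd: "pure_tensor d n (u(k := x)) =
      (\<lambda>i. if i \<in> tensor_index d n then x $ i k * (\<Prod>j\<in>{..<d} - {k}. u j $ i j) else 0)"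
    if "k < d" for u :: "nat \<Rightarrow> 'k vec" and k x
    using that by (auto simp: pure_tensor_def fun_eq_iff prod.remove[of "{..<d}" k])
  have lt: "i k < n" if "i \<in> tensor_index d n" "k < d" for i k
    using that by (auto simp: tensor_index_def PiE_iff)
  have F: "F (\<lambda>i. v i + w i) = F v + F w" "F (\<lambda>i. c * v i) = scale c (F v)"
    if "v \<in> tensors d n" "w \<in> tensors d n" for v w c
    using assms that by (simp_all add: tensor_linear_def)
  have "F (pure_tensor d n (u(k := x + y))) =
      F (pure_tensor d n (u(k := x))) + F (pure_tensor d n (u(k := y)))"
    if "k < d" "x \<in> carrier_vec n" "y \<in> carrier_vec n" for u :: "nat \<Rightarrow> 'k vec" and k x y
  proof -
    have "pure_tensor d n (u(k := x + y)) =
        (\<lambda>i. pure_tensor d n (u(k := x)) i + pure_tensor d n (u(k := y)) i)"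
      using that by (auto simp: upd fun_eq_iff lt distrib_right)
    then show ?thesis by (simp only: F tensors_pure_tensor)
  qed
  moreover have "F (pure_tensor d n (u(k := c \<cdot>\<^sub>v x))) = scale c (F (pure_tensor d n (u(k := x))))"
    if "k < d" "x \<in> carrier_vec n" for u :: "nat \<Rightarrow> 'k vec" and k c x
  proof -
    have "pure_tensor d n (u(k := c \<cdot>\<^sub>v x)) = (\<lambda>i. c * pure_tensor d n (u(k := x)) i)"
      using that by (auto simp: upd fun_eq_iff lt mult.assoc)
    then show ?thesis by (simp only: F(2)[OF tensors_pure_tensor tensors_pure_tensor])
  qed
  moreover have "F (pure_tensor d n u) = F (pure_tensor d n u')"
    if "\<forall>k<d. u k = u' k" for u u' :: "nat \<Rightarrow> 'k vec"
  proof -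
    have "pure_tensor d n u = pure_tensor d n u'"
      using that by (auto simp: pure_tensor_def fun_eq_iff)
    then show ?thesis by simp
  qed
  ultimately show ?thesis
    unfolding multilinear_def by blast
qed

theorem tensors_universal:
  fixes scale :: "'k::field \<Rightarrow> 'w::ab_group_add \<Rightarrow> 'w"
  assumes vs: "vector_space scale" and f: "multilinear d n scale f"
  shows "\<exists>F. tensor_linear d n scale F \<and>
           (\<forall>u. (\<forall>k<d. u k \<in> carrier_vec n) \<longrightarrow> F (pure_tensor d n u) = f u) \<and>
           (\<forall>G. tensor_linear d n scale G \<longrightarrow>
              (\<forall>u. (\<forall>k<d. u k \<in> carrier_vec n) \<longrightarrow> G (pure_tensor d n u) = f u) \<longrightarrow>
              (\<forall>v\<in>tensors d n. G v = F v))"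
proof -
  interpret vector_space scale by fact
  define e :: "(nat \<Rightarrow> nat) \<Rightarrow> (nat \<Rightarrow> nat) \<Rightarrow> 'k"
    where "e i = pure_tensor d n (\<lambda>k. unit_vec n (i k))" for i :: "nat \<Rightarrow> nat"
  define F where "F v = (\<Sum>i\<in>tensor_index d n. scale (v i) (f (\<lambda>k. unit_vec n (i k))))"
    for v :: "(nat \<Rightarrow> nat) \<Rightarrow> 'k"
  have F_linear: "tensor_linear d n scale F"
    by (simp add: tensor_linear_def F_def scale_left_distrib sum.distrib scale_sum_right)
  have F_pure: "F (pure_tensor d n u) = f u" if "\<forall>k<d. u k \<in> carrier_vec n" for u
    using multilinear_expand[OF vs f, of u] that by (simp add: F_def pure_tensor_def)
  have F_unique: "G v = F v"
    if G: "tensor_linear d n scale G"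
      and Gf: "\<forall>u. (\<forall>k<d. u k \<in> carrier_vec n) \<longrightarrow> G (pure_tensor d n u) = f u"
      and v: "v \<in> tensors d n" for G v
  proof -
    have Gadd: "G (\<lambda>i. a i + b i) = G a + G b" if "a \<in> tensors d n" "b \<in> tensors d n" for a b
      using G that by (simp add: tensor_linear_def)
    have Gsm: "G (\<lambda>i. c * a i) = scale c (G a)" if "a \<in> tensors d n" for c a
      using G that by (simp add: tensor_linear_def)
    have e_eq: "e j i = (if i = j then 1 else 0)" if "j \<in> tensor_index d n" for i j
    proof (cases "i \<in> tensor_index d n")
      case True
      have lt: "i k < n" "j k < n" if "k < d" for k
        using that True \<open>j \<in> _\<close> by (auto simp: tensor_index_def PiE_iff)
      have "i = j \<longleftrightarrow> (\<forall>k<d. i k = j k)"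
        using True \<open>j \<in> _\<close> unfolding tensor_index_def by (auto intro: PiE_ext)
      moreover have "e j i = (\<Prod>k<d. if i k = j k then 1 else 0)"
        using True lt by (auto simp: e_def pure_tensor_def intro!: prod.cong)
      ultimately show ?thesis
        by (auto intro!: prod_zero)
    qed (use that in \<open>auto simp: e_def pure_tensor_def\<close>)
    have expand: "G (\<lambda>i. \<Sum>j\<in>A. v j * e j i) = (\<Sum>j\<in>A. scale (v j) (f (\<lambda>k. unit_vec n (j k))))"
      if "finite A" for A
      using that
    proof (induction A)
      case empty
      have "(\<lambda>_. 0) \<in> tensors d n" by (simp add: tensors_def)
      from Gsm[OF this, of 0] show ?case by simp
    next
      case (insert j A)
      have et: "e i \<in> tensors d n" for i by (simp add: e_def tensors_pure_tensor)
      have t: "(\<lambda>i. v j * e j i) \<in> tensors d n" "(\<lambda>i. \<Sum>j\<in>A. v j * e j i) \<in> tensors d n"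
        using et by (auto simp: tensors_def intro!: sum.neutral)
      have "G (e j) = f (\<lambda>k. unit_vec n (j k))" using Gf by (simp add: e_def)
      then show ?case
        using insert Gadd[OF t] Gsm[OF et, of "v j" j] by simp
    qed
    have v_eq: "(\<lambda>i. \<Sum>j\<in>tensor_index d n. v j * e j i) = v"
    proof
      fix i
      have "(\<Sum>j\<in>tensor_index d n. v j * e j i) = (\<Sum>j\<in>tensor_index d n. if i = j then v j else 0)"
        by (intro sum.cong) (simp_all add: e_eq)
      then show "(\<Sum>j\<in>tensor_index d n. v j * e j i) = v i"
        using v by (simp add: tensors_def)
    qed
    show ?thesis
      using expand[OF finite_tensor_index[of d n]] unfolding v_eq F_def .
  qed
  show ?thesis
  proof (intro exI[of _ F] conjI allI impI ballI)
    show "tensor_linear d n scale F" by (fact F_linear)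
  qed (fact F_pure F_unique)+
qed

end

theory Submission
  imports Defs "HOL-Analysis.Function_Topology"
begin

text \<open>
  Kempf's argument, carried out over \<open>K\<close> itself. A one-parameter subgroup of \<open>SL(V)\<close> is
  diagonal in some basis over \<open>K\<close>, so it amounts to a basis with integer weights of sum zero,
  and its limit behaviour depends only on the filtration of \<open>V\<close> by weight. If \<open>v\<close> is
  \<open>SL(V)\<^sup>d\<close>-unstable, take among the families of \<open>d\<close> such filtrations with real weights, under
  which all components of \<open>v\<close> have total weight at least 1, one whose weights have the least sum
  of squares. As \<open>v\<close> is symmetric, exchanging two members of the family gives another minimiser.
  Two filtrations always have a common basis, in which the midpoint of the two families can be
  formed, so strict convexity forces all members to be equal. Rounding the weights of this
  common filtration to integers gives a destabilising one-parameter subgroup of \<open>SL(V)\<close>.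
\<close>

section \<open>The action on tensors\<close>

lemma tensor_index_less: "i \<in> tensor_index d n \<Longrightarrow> k < d \<Longrightarrow> i k < n"
  by (auto simp: tensor_index_def PiE_iff)

lemma tensor_act_outside [simp]: "i \<notin> tensor_index d n \<Longrightarrow> tensor_act d n g v i = 0"
  by (simp add: tensor_act_def)

lemma tensor_act_cong:
  assumes "\<And>k. k < d \<Longrightarrow> g k = h k"
  shows "tensor_act d n g v = tensor_act d n h v"
proof -
  have "(\<Prod>k<d. g k $$ (i k, j k)) = (\<Prod>k<d. h k $$ (i k, j k))" for i j
    using assms by (intro prod.cong) auto
  then show ?thesis unfolding tensor_act_def by presburger
qed

lemma index_mult_mat_sum:
  fixes A B :: "'r::semiring_0 mat"
  assumes "A \<in> carrier_mat n n" "B \<in> carrier_mat n n" "i < n" "j < n"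
  shows "(A * B) $$ (i, j) = (\<Sum>l<n. A $$ (i, l) * B $$ (l, j))"
  using assms by (simp add: scalar_prod_def lessThan_atLeast0)

text \<open>Functoriality of the tensor product: \<open>prod_sum_PiE\<close> turns a product of
  matrix-product entries into a single sum over the intermediate multi-index.\<close>

lemma tensor_act_mult:
  assumes g: "\<And>k. k < d \<Longrightarrow> g k \<in> carrier_mat n n"
    and h: "\<And>k. k < d \<Longrightarrow> h k \<in> carrier_mat n n"
  shows "tensor_act d n g (tensor_act d n h v) = tensor_act d n (\<lambda>k. g k * h k) v"
proof
  fix i
  show "tensor_act d n g (tensor_act d n h v) i = tensor_act d n (\<lambda>k. g k * h k) v i"
  proof (cases "i \<in> tensor_index d n")
    case i: True
    let ?I = "tensor_index d n"
    have "(\<Sum>j\<in>?I. (\<Prod>k<d. g k $$ (i k, j k)) * (\<Prod>k<d. h k $$ (j k, m k))) =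
        (\<Prod>k<d. (g k * h k) $$ (i k, m k))" if m: "m \<in> ?I" for m
    proof -
      have "(\<Prod>k<d. (g k * h k) $$ (i k, m k)) =
          (\<Prod>k<d. \<Sum>l<n. g k $$ (i k, l) * h k $$ (l, m k))"
        using i m g h by (intro prod.cong) (auto simp: index_mult_mat_sum tensor_index_less)
      also have "\<dots> = (\<Sum>j\<in>?I. \<Prod>k<d. g k $$ (i k, j k) * h k $$ (j k, m k))"
        unfolding tensor_index_def by (rule prod_sum_PiE) auto
      finally show ?thesis by (simp add: prod.distrib)
    qed
    then have "tensor_act d n (\<lambda>k. g k * h k) v i =
        (\<Sum>m\<in>?I. (\<Sum>j\<in>?I. (\<Prod>k<d. g k $$ (i k, j k)) * (\<Prod>k<d. h k $$ (j k, m k))) * v m)"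
      using i by (simp add: tensor_act_def)
    also have "\<dots> = (\<Sum>m\<in>?I. \<Sum>j\<in>?I.
        (\<Prod>k<d. g k $$ (i k, j k)) * ((\<Prod>k<d. h k $$ (j k, m k)) * v m))"
      by (simp add: sum_distrib_right mult.assoc)
    also have "\<dots> = tensor_act d n g (tensor_act d n h v) i"
      using i by (subst sum.swap) (simp add: tensor_act_def sum_distrib_left)
    finally show ?thesis by simp
  qed simp
qed

lemma tensor_act_diag:
  assumes g: "\<And>k a b. k < d \<Longrightarrow> a < n \<Longrightarrow> b < n \<Longrightarrow>
      g k $$ (a, b) = (if a = b then c k a else 0)"
    and i: "i \<in> tensor_index d n"
  shows "tensor_act d n g v i = (\<Prod>k<d. c k (i k)) * v i"
proof -
  have "(\<Prod>k<d. g k $$ (i k, j k)) * v j = (if j = i then (\<Prod>k<d. c k (i k)) * v i else 0)"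
    if j: "j \<in> tensor_index d n" for j
  proof (cases "j = i")
    case True
    then show ?thesis using i g by (simp add: tensor_index_less)
  next
    case False
    then obtain k where "k < d" "i k \<noteq> j k"
      using i j unfolding tensor_index_def by (metis PiE_ext lessThan_iff)
    then have "(\<Prod>k<d. g k $$ (i k, j k)) = 0"
      using g i j by (intro prod_zero) (auto simp: tensor_index_less intro!: bexI[of _ k])
    then show ?thesis using False by simp
  qed
  then show ?thesis
    using i by (simp add: tensor_act_def)
qed

lemma tensor_act_one:
  assumes "v \<in> tensors d n" and "\<And>k. k < d \<Longrightarrow> g k = 1\<^sub>m n"
  shows "tensor_act d n g v = v"
proof
  fix i
  show "tensor_act d n g v i = v i"
  proof (cases "i \<in> tensor_index d n")
    case True
    then show ?thesis
      using tensor_act_diag[of d n g "\<lambda>_ _. 1" i v] assms by simp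
  qed (use assms in \<open>simp add: tensors_def\<close>)
qed

lemma tensor_act_tensors: "tensor_act d n g v \<in> tensors d n"
  by (simp add: tensors_def)

text \<open>Substituting \<open>j \<circ> \<sigma>\<close> for the summation index costs nothing
  because \<open>v\<close> is symmetric, and the product over positions is then reindexed by
  \<open>\<sigma>\<close>. This lets two factors be exchanged later.\<close>

lemma tensor_act_permute:
  assumes v: "v \<in> symmetric_tensors d n" and s: "\<sigma> permutes {..<d}"
  shows "tensor_act d n (g \<circ> \<sigma>) v (i \<circ> \<sigma>) = tensor_act d n g v i"
proof -
  let ?I = "tensor_index d n"
  have vs: "v (j \<circ> \<sigma>) = v j" for j
    using v s unfolding symmetric_tensors_def permute_tensor_def by (auto dest: fun_cong)
  have "bij_betw (\<lambda>j. j \<circ> \<sigma>) ?I ?I"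
  proof (rule bij_betwI[where g = "\<lambda>j. j \<circ> inv_into UNIV \<sigma>"])
    show "(\<lambda>j. j \<circ> \<sigma>) \<in> ?I \<rightarrow> ?I" "(\<lambda>j. j \<circ> inv_into UNIV \<sigma>) \<in> ?I \<rightarrow> ?I"
      using comp_permutes_tensor_index[OF s]
        comp_permutes_tensor_index[OF permutes_inv[OF s]] by auto
  qed (simp_all add: comp_assoc permutes_inv_o[OF s])
  then have "(\<Sum>j\<in>?I. (\<Prod>k<d. g (\<sigma> k) $$ (i (\<sigma> k), j k)) * v j) =
      (\<Sum>j\<in>?I. (\<Prod>k<d. g (\<sigma> k) $$ (i (\<sigma> k), (j \<circ> \<sigma>) k)) * v (j \<circ> \<sigma>))"
    by (rule sum.reindex_bij_betw[symmetric])
  also have "\<dots> = (\<Sum>j\<in>?I. (\<Prod>k<d. g k $$ (i k, j k)) * v j)"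
    unfolding vs using prod.permute[OF s, of "\<lambda>k. g k $$ (i k, _ k)"]
    by (simp add: o_def)
  finally show ?thesis
    by (simp add: tensor_act_def comp_permutes_tensor_index[OF s])
qed

section \<open>Weighted bases and filtrations\<close>

text \<open>The inverse is carried along because it reads off coordinates: column \<open>j\<close>
  of \<open>Q' * P\<close> holds the \<open>j\<close>-th vector of the basis \<open>P\<close> in the
  basis with inverse \<open>Q'\<close>, and \<open>tensor_act d n Q v\<close> holds the coordinates
  of \<open>v\<close> in the bases with inverses \<open>Q k\<close>.\<close>

definition inverse_mats :: "nat \<Rightarrow> 'k::field mat \<Rightarrow> 'k mat \<Rightarrow> bool" where
  "inverse_mats n P Q \<longleftrightarrow>
     P \<in> carrier_mat n n \<and> Q \<in> carrier_mat n n \<and> P * Q = 1\<^sub>m n \<and> Q * P = 1\<^sub>m n"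

text \<open>
  Basis \<open>P\<close> (with inverse \<open>Q\<close>) and weights \<open>w\<close> encode the filtration whose step \<open>a\<close> is
  spanned by the columns of \<open>P\<close> of weight at least \<open>a\<close>. The relation below says that each
  step of \<open>(P, w)\<close> is contained in the same step of \<open>(P', w')\<close>.
\<close>

definition filt_le ::
    "nat \<Rightarrow> 'k::field mat \<Rightarrow> (nat \<Rightarrow> real) \<Rightarrow> 'k mat \<Rightarrow> (nat \<Rightarrow> real) \<Rightarrow> bool" where
  "filt_le n P w Q' w' \<longleftrightarrow> (\<forall>i<n. \<forall>j<n. (Q' * P) $$ (i, j) \<noteq> 0 \<longrightarrow> w j \<le> w' i)"

definition filt_eq ::
    "nat \<Rightarrow> 'k::field mat \<times> 'k mat \<times> (nat \<Rightarrow> real) \<Rightarrow> 'k mat \<times> 'k mat \<times> (nat \<Rightarrow> real) \<Rightarrow> bool" where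
  "filt_eq n = (\<lambda>(P, Q, w) (P', Q', w'). filt_le n P w Q' w' \<and> filt_le n P' w' Q w)"

lemma mult_cancel_inner:
  fixes A B C D :: "'k::field mat"
  assumes "A \<in> carrier_mat n n" "inverse_mats n B C" "D \<in> carrier_mat n n"
  shows "(A * B) * (C * D) = A * D"
proof -
  have B: "B \<in> carrier_mat n n" "C \<in> carrier_mat n n" "B * C = 1\<^sub>m n"
    using assms by (auto simp: inverse_mats_def)
  have "(A * B) * (C * D) = A * (B * (C * D))"
    using assms B by (intro assoc_mult_mat) auto
  also have "B * (C * D) = (B * C) * D"
    using assms B by (intro assoc_mult_mat[symmetric]) auto
  finally show ?thesis using assms B by simp
qed

lemma inverse_mats_sym: "inverse_mats n P Q \<Longrightarrow> inverse_mats n Q P"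
  by (auto simp: inverse_mats_def)

lemma inverse_mats_mult:
  assumes "inverse_mats n P Q" "inverse_mats n A B"
  shows "inverse_mats n (P * A) (B * Q)"
proof -
  have c: "P \<in> carrier_mat n n" "Q \<in> carrier_mat n n" "A \<in> carrier_mat n n" "B \<in> carrier_mat n n"
    using assms by (auto simp: inverse_mats_def)
  note mult_cancel_inner[OF c(1) assms(2) c(2)]
    mult_cancel_inner[OF c(4) inverse_mats_sym[OF assms(1)] c(3)]
  then show ?thesis using assms by (auto simp: inverse_mats_def)
qed

text \<open>A nonzero entry of \<open>Q3 * P1 = (Q3 * P2) * (Q2 * P1)\<close> needs an intermediate
  index at which both factors are nonzero, and there the two weight inequalities chain.\<close>

lemma filt_le_trans:
  assumes 1: "P1 \<in> carrier_mat n n" and 2: "inverse_mats n P2 Q2" and 3: "Q3 \<in> carrier_mat n n"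
    and le: "filt_le n P1 w1 Q2 w2" "filt_le n P2 w2 Q3 w3"
  shows "filt_le n P1 w1 Q3 w3"
  unfolding filt_le_def
proof (intro allI impI)
  fix i j assume ij: "i < n" "j < n" and nz: "(Q3 * P1) $$ (i, j) \<noteq> 0"
  have "(Q3 * P1) $$ (i, j) = ((Q3 * P2) * (Q2 * P1)) $$ (i, j)"
    using mult_cancel_inner[OF 3 2 1] by simp
  also have "\<dots> = (\<Sum>l<n. (Q3 * P2) $$ (i, l) * (Q2 * P1) $$ (l, j))"
    using 1 2 3 ij by (intro index_mult_mat_sum) (auto simp: inverse_mats_def)
  finally obtain l where "l < n" "(Q3 * P2) $$ (i, l) \<noteq> 0" "(Q2 * P1) $$ (l, j) \<noteq> 0"
    using nz by (metis (no_types, lifting) lessThan_iff mult_zero_left mult_zero_right sum.neutral)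
  then show "w1 j \<le> w3 i"
    using le ij unfolding filt_le_def by (meson order_trans)
qed

text \<open>Some summand of the Leibniz formula must be nonzero.\<close>

lemma det_nonzero_transversal:
  fixes A :: "'k::field mat"
  assumes "A \<in> carrier_mat n n" "det A \<noteq> 0"
  obtains p where "p permutes {..<n}" "\<And>i. i < n \<Longrightarrow> A $$ (i, p i) \<noteq> 0"
proof -
  obtain p where p: "p permutes {0..<n}" "signof p * (\<Prod>i = 0..<n. A $$ (i, p i)) \<noteq> 0"
    using assms(2) unfolding det_def'[OF assms(1)]
    by (metis (no_types, lifting) mem_Collect_eq sum.neutral)
  then show ?thesis by (intro that[of p]) (auto simp: lessThan_atLeast0)
qed

lemma inverse_mats_det: "inverse_mats n P Q \<Longrightarrow> det P \<noteq> 0"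
  unfolding inverse_mats_def by (metis det_mult det_one mult_zero_left zero_neq_one)

text \<open>The transition matrix is invertible, so a transversal of nonzero entries matches the two
  bases, and \<open>filt_le\<close> compares weights along it.\<close>

lemma filt_le_permutation:
  assumes "inverse_mats n P Q" "inverse_mats n P' Q'" "filt_le n P w Q' w'"
  obtains p where "p permutes {..<n}" "\<And>i. i < n \<Longrightarrow> w (p i) \<le> w' i"
proof -
  have "inverse_mats n (Q' * P) (Q * P')"
    using assms inverse_mats_mult inverse_mats_sym by blast
  then have "Q' * P \<in> carrier_mat n n" "det (Q' * P) \<noteq> 0"
    using inverse_mats_det by (auto simp: inverse_mats_def)
  then obtain p where p: "p permutes {..<n}" "\<And>i. i < n \<Longrightarrow> (Q' * P) $$ (i, p i) \<noteq> 0"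
    by (rule det_nonzero_transversal) blast
  moreover have "p i < n" if "i < n" for i
    using p(1) that permutes_in_image by fastforce
  ultimately show ?thesis
    using assms(3) by (intro that[of p]) (auto simp: filt_le_def)
qed

text \<open>Equal filtrations have the same multiset of weights; testing against all
  \<open>f\<close> records this. Later \<open>f\<close> is the identity for the weight sum and the
  square for the norm.\<close>

lemma filt_eq_sum:
  fixes f :: "real \<Rightarrow> real"
  assumes "inverse_mats n P Q" "inverse_mats n P' Q'" "filt_eq n (P, Q, w) (P', Q', w')"
  shows "(\<Sum>i<n. f (w i)) = (\<Sum>i<n. f (w' i))"
proof -
  obtain p where p: "p permutes {..<n}" "\<And>i. i < n \<Longrightarrow> w (p i) \<le> w' i"
    using filt_le_permutation[of n P Q P' Q' w w'] assms by (auto simp: filt_eq_def)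
  obtain q where q: "q permutes {..<n}" "\<And>i. i < n \<Longrightarrow> w' (q i) \<le> w i"
    using filt_le_permutation[of n P' Q' P Q w' w] assms by (auto simp: filt_eq_def)
  \<comment> \<open>The bounds along \<open>p\<close> and \<open>q\<close> make the two totals
    equal, so the inequalities along \<open>p\<close> cannot be strict anywhere.\<close>
  have "(\<Sum>i<n. w' i) = (\<Sum>i<n. w' (q i))" "(\<Sum>i<n. w i) = (\<Sum>i<n. w (p i))"
    using sum.permute[OF q(1), of w'] sum.permute[OF p(1), of w] by (simp_all add: o_def)
  moreover have "(\<Sum>i<n. w' (q i)) \<le> (\<Sum>i<n. w i)" "(\<Sum>i<n. w (p i)) \<le> (\<Sum>i<n. w' i)"
    using p q by (auto intro: sum_mono)
  ultimately have "(\<Sum>i<n. w' i - w (p i)) = 0"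
    by (simp add: sum_subtractf)
  then have "\<And>i. i < n \<Longrightarrow> w' i = w (p i)"
    using p(2) by (subst (asm) sum_nonneg_eq_0_iff) auto
  then show ?thesis
    using sum.permute[OF p(1), of "\<lambda>i. f (w i)"] by (simp add: o_def)
qed

section \<open>A common basis for two filtrations\<close>

lemma filt_eq_sym: "filt_eq n x y \<Longrightarrow> filt_eq n y x"
  by (auto simp: filt_eq_def split: prod.splits)

lemma filt_eq_trans:
  assumes "inverse_mats n P1 Q1" "inverse_mats n P2 Q2" "inverse_mats n P3 Q3"
    and "filt_eq n (P1, Q1, w1) (P2, Q2, w2)" "filt_eq n (P2, Q2, w2) (P3, Q3, w3)"
  shows "filt_eq n (P1, Q1, w1) (P3, Q3, w3)"
proof -
  have "filt_le n P1 w1 Q3 w3"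
    using assms by (intro filt_le_trans[of P1 n P2 Q2 Q3 w1 w2 w3])
      (auto simp: filt_eq_def inverse_mats_def)
  moreover have "filt_le n P3 w3 Q1 w1"
    using assms by (intro filt_le_trans[of P3 n P2 Q2 Q1 w3 w2 w1])
      (auto simp: filt_eq_def inverse_mats_def)
  ultimately show ?thesis by (simp add: filt_eq_def)
qed

text \<open>Column \<open>j\<close> of \<open>A\<close>, and of its inverse, involves only basis
  vectors of weight at least \<open>w j\<close>; such a base change keeps every step of the
  filtration.\<close>

lemma filt_eq_mult:
  assumes PQ: "inverse_mats n P Q" and AB: "inverse_mats n A B"
    and "\<And>i j. i < n \<Longrightarrow> j < n \<Longrightarrow> A $$ (i, j) \<noteq> 0 \<Longrightarrow> w j \<le> w i"
    and "\<And>i j. i < n \<Longrightarrow> j < n \<Longrightarrow> B $$ (i, j) \<noteq> 0 \<Longrightarrow> w j \<le> w i"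
  shows "filt_eq n (P, Q, w) (P * A, B * Q, w)"
proof -
  have c: "P \<in> carrier_mat n n" "Q \<in> carrier_mat n n" "A \<in> carrier_mat n n" "B \<in> carrier_mat n n"
    "Q * P = 1\<^sub>m n"
    using assms by (auto simp: inverse_mats_def)
  have "B * Q * P = B" "Q * (P * A) = A"
    using c by (simp_all add: assoc_mult_mat[of B n n Q n P n] assoc_mult_mat[of Q n n P n A n, symmetric])
  then show ?thesis using assms by (simp add: filt_eq_def filt_le_def)
qed

lemma filt_eq_refl: "inverse_mats n P Q \<Longrightarrow> filt_eq n (P, Q, w) (P, Q, w)"
  by (auto simp: filt_eq_def filt_le_def inverse_mats_def)

section \<open>Shear matrices \<open>I + u x^T\<close> and elimination at a pivot\<close>

definition shear_mat :: "nat \<Rightarrow> (nat \<Rightarrow> 'k::field) \<Rightarrow> (nat \<Rightarrow> 'k) \<Rightarrow> 'k mat" where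
  "shear_mat n u x = mat n n (\<lambda>(i, j). (if i = j then 1 else 0) + u i * x j)"

lemma shear_mat_carrier [simp]: "shear_mat n u x \<in> carrier_mat n n"
  by (simp add: shear_mat_def)

lemma shear_mat_index: "i < n \<Longrightarrow> j < n \<Longrightarrow>
    shear_mat n u x $$ (i, j) = (if i = j then 1 else 0) + u i * x j"
  by (simp add: shear_mat_def)

lemma mult_shear_mat:
  assumes "M \<in> carrier_mat n n" "i < n" "j < n"
  shows "(M * shear_mat n u x) $$ (i, j) = M $$ (i, j) + (\<Sum>l<n. M $$ (i, l) * u l) * x j"
proof -
  have "(M * shear_mat n u x) $$ (i, j) =
      (\<Sum>l<n. (if l = j then M $$ (i, l) else 0) + M $$ (i, l) * u l * x j)"
    using assms by (subst index_mult_mat_sum) (auto simp: shear_mat_index algebra_simps intro!: sum.cong)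
  then show ?thesis using assms by (simp add: sum.distrib sum_distrib_right)
qed

lemma shear_mat_mult:
  assumes "M \<in> carrier_mat n n" "i < n" "j < n"
  shows "(shear_mat n u x * M) $$ (i, j) = M $$ (i, j) + u i * (\<Sum>l<n. x l * M $$ (l, j))"
proof -
  have "(shear_mat n u x * M) $$ (i, j) =
      (\<Sum>l<n. (if l = i then M $$ (l, j) else 0) + u i * (x l * M $$ (l, j)))"
    using assms by (subst index_mult_mat_sum) (auto simp: shear_mat_index algebra_simps intro!: sum.cong)
  then show ?thesis using assms by (simp add: sum.distrib sum_distrib_left)
qed

text \<open>The rank one part \<open>u x^T\<close> squares to
  \<open>(x . u) u x^T = 0\<close>.\<close>

lemma shear_mat_inverse:
  assumes "(\<Sum>l<n. x l * u l) = 0"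
  shows "inverse_mats n (shear_mat n u x) (shear_mat n u (\<lambda>i. - x i))"
proof -
  have "shear_mat n u x * shear_mat n u (\<lambda>i. - x i) = 1\<^sub>m n" (is "?A * ?B = _")
  proof (rule eq_matI)
    fix i j assume ij: "i < dim_row (1\<^sub>m n :: 'a mat)" "j < dim_col (1\<^sub>m n :: 'a mat)"
    have "(\<Sum>l<n. ?A $$ (i, l) * u l) = (\<Sum>l<n. (if l = i then u l else 0) + u i * (x l * u l))"
      using ij by (auto simp: shear_mat_index algebra_simps intro!: sum.cong)
    also have "\<dots> = u i"
      using ij assms by (simp add: sum.distrib flip: sum_distrib_left)
    finally show "(?A * ?B) $$ (i, j) = 1\<^sub>m n $$ (i, j)"
      using ij by (subst mult_shear_mat) (auto simp: shear_mat_index)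
  qed (simp_all add: shear_mat_def)
  then show ?thesis
    unfolding inverse_mats_def
    using mat_mult_left_right_inverse[OF shear_mat_carrier shear_mat_carrier] by auto
qed

text \<open>Progress measure for the elimination; an invertible matrix whose nonzero entries are all
  isolated is monomial.\<close>

definition isolated_entries :: "nat \<Rightarrow> 'k::field mat \<Rightarrow> (nat \<times> nat) set" where
  "isolated_entries n M = {(i, j). i < n \<and> j < n \<and> M $$ (i, j) \<noteq> 0 \<and>
     (\<forall>l<n. l \<noteq> j \<longrightarrow> M $$ (i, l) = 0) \<and> (\<forall>k<n. k \<noteq> i \<longrightarrow> M $$ (k, j) = 0)}"

lemma isolated_entries_subset: "isolated_entries n M \<subseteq> {..<n} \<times> {..<n}"
  by (auto simp: isolated_entries_def)

lemma finite_isolated_entries: "finite (isolated_entries n M)"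
  by (rule finite_subset[OF isolated_entries_subset]) simp

text \<open>The right shear clears the pivot row, the left one the pivot column. An entry isolated
  before lies in a row with zero in column \<open>j\<close> and in a column with zero in row
  \<open>i\<close>, so it stays isolated, and the pivot joins it.\<close>

lemma isolate_pivot:
  fixes M :: "'k::field mat"
  assumes M: "M \<in> carrier_mat n n" and ij: "i < n" "j < n"
    and pivot: "M $$ (i, j) \<noteq> 0" "(i, j) \<notin> isolated_entries n M"
  defines "u \<equiv> \<lambda>k. if k = i then 0 else - M $$ (k, j) / M $$ (i, j)"
    and "x \<equiv> \<lambda>l. if l = j then 0 else - M $$ (i, l) / M $$ (i, j)"
  defines "N \<equiv> shear_mat n u (\<lambda>k. if k = i then 1 else 0) *
      (M * shear_mat n (\<lambda>l. if l = j then 1 else 0) x)"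
  shows "card (isolated_entries n M) < card (isolated_entries n N)"
proof -
  let ?A = "shear_mat n (\<lambda>l. if l = j then 1 else 0) x"
  have MA: "M * ?A \<in> carrier_mat n n" using M by auto
  have MA_index: "(M * ?A) $$ (k, l) = M $$ (k, l) + M $$ (k, j) * x l" if "k < n" "l < n" for k l
    using mult_shear_mat[OF M that] ij
    by (simp add: if_distrib[of "times _"] cong: if_cong)
  \<comment> \<open>Outside the pivot row and column this is the Schur complement.\<close>
  have N_index: "N $$ (k, l) = (if l = j then if k = i then M $$ (i, j) else 0 else
      if k = i then 0 else M $$ (k, l) - M $$ (k, j) * M $$ (i, l) / M $$ (i, j))"
    if "k < n" "l < n" for k l
  proof -
    have "N $$ (k, l) = (M * ?A) $$ (k, l) + u k * (M * ?A) $$ (i, l)"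
      unfolding N_def using shear_mat_mult[OF MA that] ij
      by (simp add: if_distrib[of "\<lambda>y. y * _"] cong: if_cong)
    then show ?thesis
      using that ij pivot(1) by (simp add: MA_index) (simp add: u_def x_def)
  qed
  have "insert (i, j) (isolated_entries n M) \<subseteq> isolated_entries n N"
  proof (rule subrelI, elim insertE)
    fix k l assume "(k, l) = (i, j)"
    then show "(k, l) \<in> isolated_entries n N"
      using ij pivot(1) by (simp add: isolated_entries_def N_index)
  next
    fix k l assume kl: "(k, l) \<in> isolated_entries n M"
    then have "k \<noteq> i" "l \<noteq> j"
      using ij pivot by (auto simp: isolated_entries_def)
    then show "(k, l) \<in> isolated_entries n N"
      using kl ij by (auto simp: isolated_entries_def N_index)
  qed
  then have "card (insert (i, j) (isolated_entries n M)) \<le> card (isolated_entries n N)"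
    by (intro card_mono finite_isolated_entries)
  then show ?thesis
    using pivot(2) by (simp add: finite_isolated_entries)
qed

text \<open>
  Bruhat decomposition: elimination with a pivot maximising \<open>a j - b i\<close> only uses row and
  column operations that preserve the two filtrations.
\<close>

lemma common_basis:
  fixes P Q P' Q' :: "'k::field mat" and a b :: "nat \<Rightarrow> real"
  assumes PQ: "inverse_mats n P Q" and PQ': "inverse_mats n P' Q'"
  obtains R S a' b' where "inverse_mats n R S"
    "filt_eq n (P, Q, a) (R, S, a')" "filt_eq n (P', Q', b) (R, S, b')"
proof -
  \<comment> \<open>Pairs of bases that still define the two given filtrations with the original
    weights.\<close>
  define ok where "ok = (\<lambda>(R, S, R', S'). inverse_mats n R S \<and> inverse_mats n R' S' \<and>
    filt_eq n (P, Q, a) (R, S, a) \<and> filt_eq n (P', Q', b) (R', S', b))"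
  define f where "f = (\<lambda>(R :: 'k mat, S :: 'k mat, R' :: 'k mat, S' :: 'k mat).
    card (isolated_entries n (S' * R)))"
  have "ok (P, Q, P', Q')"
    using PQ PQ' by (simp add: ok_def filt_eq_refl)
  moreover have "f y \<le> n * n" for y
  proof -
    have "card (isolated_entries n N) \<le> n * n" for N :: "'k mat"
      using card_mono[OF _ isolated_entries_subset, of n N] by simp
    then show ?thesis by (simp add: f_def split: prod.splits)
  qed
  \<comment> \<open>Take a pair whose transition matrix has as many isolated entries as possible;
    the bound \<open>n * n\<close> makes the maximum exist.\<close>
  ultimately obtain z where z: "ok z" "\<And>y. ok y \<Longrightarrow> f y \<le> f z"
    using ex_has_greatest_nat[of ok "(P, Q, P', Q')" f "Suc (n * n)"] by (auto simp: less_Suc_eq_le)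
  obtain R S R' S' where z_eq: "z = (R, S, R', S')" by (cases z)
  have RS: "inverse_mats n R S" and RS': "inverse_mats n R' S'"
    and eq: "filt_eq n (P, Q, a) (R, S, a)" and eq': "filt_eq n (P', Q', b) (R', S', b)"
    using z(1) by (auto simp: ok_def z_eq)
  define M where "M = S' * R"
  have c: "R \<in> carrier_mat n n" "S \<in> carrier_mat n n" "R' \<in> carrier_mat n n" "S' \<in> carrier_mat n n"
    using RS RS' by (auto simp: inverse_mats_def)
  have M: "M \<in> carrier_mat n n" using c by (auto simp: M_def)
  have isolated: "(i, j) \<in> isolated_entries n M" if "i < n" "j < n" "M $$ (i, j) \<noteq> 0" for i j
  proof (rule ccontr)
    define T where "T = {(i, j). i < n \<and> j < n \<and> M $$ (i, j) \<noteq> 0} - isolated_entries n M"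
    assume "(i, j) \<notin> isolated_entries n M"
    then have "T \<noteq> {}" using that by (auto simp: T_def)
    moreover have "finite T"
      by (rule finite_subset[of _ "{..<n} \<times> {..<n}"]) (auto simp: T_def)
    ultimately obtain t where "t \<in> T" "\<And>s. s \<in> T \<Longrightarrow> a (snd s) - b (fst s) \<le> a (snd t) - b (fst t)"
      using ex_min_if_finite[of "(\<lambda>s. b (fst s) - a (snd s)) ` T"] by (force simp: not_less)
    then obtain p q where pq: "(p, q) \<in> T"
        and max: "\<And>k l. (k, l) \<in> T \<Longrightarrow> a l - b k \<le> a q - b p"
      by (metis fst_conv snd_conv surj_pair)
    have pq': "p < n" "q < n" "M $$ (p, q) \<noteq> 0" "(p, q) \<notin> isolated_entries n M"
      using pq by (auto simp: T_def)
    define u where "u = (\<lambda>k. if k = p then 0 else - M $$ (k, q) / M $$ (p, q))"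
    define x where "x = (\<lambda>l. if l = q then 0 else - M $$ (p, l) / M $$ (p, q))"
    define A where "A = shear_mat n (\<lambda>l. if l = q then 1 else 0) x"
    define A' where "A' = shear_mat n (\<lambda>l. if l = q then 1 else 0) (\<lambda>i. - x i)"
    define B where "B = shear_mat n u (\<lambda>k. if k = p then 1 else 0)"
    define B' where "B' = shear_mat n u (\<lambda>k. - (if k = p then 1 else 0))"
    have A: "inverse_mats n A A'" unfolding A_def A'_def
      by (rule shear_mat_inverse) (auto simp: x_def intro!: sum.neutral)
    have B: "inverse_mats n B B'" unfolding B_def B'_def
      by (rule shear_mat_inverse) (auto simp: u_def intro!: sum.neutral)
    \<comment> \<open>Row \<open>p\<close> has two nonzero entries, so \<open>(p, l)\<close> is not
      isolated either; at equal \<open>p\<close>, maximality compares \<open>a\<close> alone. The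
      fact \<open>col\<close> is dual.\<close>
    have row: "a l \<le> a q" if "l < n" "x l \<noteq> 0" for l
    proof -
      have "l \<noteq> q" "M $$ (p, l) \<noteq> 0"
        using that by (auto simp: x_def split: if_splits)
      then have "(p, l) \<in> T"
        using that pq' by (auto simp: T_def isolated_entries_def)
      then show ?thesis using max by fastforce
    qed
    have col: "b p \<le> b k" if "k < n" "u k \<noteq> 0" for k
    proof -
      have "k \<noteq> p" "M $$ (k, q) \<noteq> 0"
        using that by (auto simp: u_def split: if_splits)
      then have "(k, q) \<in> T"
        using that pq' by (auto simp: T_def isolated_entries_def)
      then show ?thesis using max by fastforce
    qed
    \<comment> \<open>The row operation \<open>B\<close> is absorbed as the base change
      \<open>B'\<close> of \<open>R'\<close>, so the transition matrix becomes
      \<open>B * (M * A)\<close>, which has more isolated entries.\<close>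
    have "inverse_mats n (R * A) (A' * S)" "inverse_mats n (R' * B') (B * S')"
      using RS RS' A B by (auto intro: inverse_mats_mult inverse_mats_sym)
    moreover have "filt_eq n (R, S, a) (R * A, A' * S, a)"
      by (rule filt_eq_mult[OF RS A])
        (auto simp: A_def A'_def shear_mat_index row split: if_splits)
    moreover have "filt_eq n (R', S', b) (R' * B', B * S', b)"
      by (rule filt_eq_mult[OF RS' inverse_mats_sym[OF B]])
        (auto simp: B_def B'_def shear_mat_index col split: if_splits)
    ultimately have "ok (R * A, A' * S, R' * B', B * S')"
      using filt_eq_trans eq eq' PQ PQ' RS RS' unfolding ok_def by blast
    then have "f (R * A, A' * S, R' * B', B * S') \<le> f z" by (rule z(2))
    moreover have "(B * S') * (R * A) = B * (M * A)"
    proof -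
      have cc: "A \<in> carrier_mat n n" "B \<in> carrier_mat n n" by (simp_all add: A_def B_def)
      have "(B * S') * (R * A) = B * (S' * (R * A))"
        using c cc by (intro assoc_mult_mat) auto
      also have "S' * (R * A) = M * A"
        unfolding M_def using c cc by (intro assoc_mult_mat[symmetric]) auto
      finally show ?thesis .
    qed
    ultimately have "card (isolated_entries n (B * (M * A))) \<le> card (isolated_entries n M)"
      by (simp add: f_def z_eq M_def)
    then show False
      using isolate_pivot[OF M pq'] unfolding A_def B_def u_def x_def by simp
  qed
  have SM: "inverse_mats n (S * R') M"
    using inverse_mats_mult[OF inverse_mats_sym[OF RS] RS'] by (simp add: M_def)
  \<comment> \<open>Invertibility together with isolation makes \<open>M\<close> monomial: up to
    scalars, \<open>R\<close> and \<open>R'\<close> consist of the same vectors, permuted by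
    \<open>p\<close>.\<close>
  obtain p where p: "p permutes {..<n}" "\<And>i. i < n \<Longrightarrow> M $$ (i, p i) \<noteq> 0"
    using det_nonzero_transversal[OF M inverse_mats_det[OF inverse_mats_sym[OF SM]]] by blast
  have pn: "p i < n" if "i < n" for i
    using permutes_in_image[OF p(1)] that by auto
  have zero: "M $$ (i, j) = 0" if "i < n" "j < n" "j \<noteq> p i" for i j
    using isolated[OF that(1) pn[OF that(1)] p(2)[OF that(1)]] that by (auto simp: isolated_entries_def)
  \<comment> \<open>Column \<open>p i\<close> of \<open>R\<close> is a multiple of column
    \<open>i\<close> of \<open>R'\<close> and so receives its weight.\<close>
  define b' where "b' = b \<circ> inv_into UNIV p"
  have b': "b' (p i) = b i" for i
    using permutes_inverses[OF p(1)] by (simp add: b'_def)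
  have "filt_le n R b' S' b"
    unfolding filt_le_def M_def[symmetric] using zero b' by (metis order_refl)
  moreover have "filt_le n R' b S b'"
    unfolding filt_le_def
  proof (intro allI impI)
    fix i j assume ij: "i < n" "j < n" and nz: "(S * R') $$ (i, j) \<noteq> 0"
    \<comment> \<open>Column \<open>p j\<close> of \<open>M\<close> has its only nonzero entry in
      row \<open>j\<close>, so the product with \<open>M\<close>, which is the identity, exposes the
      entry \<open>(i, j)\<close> of \<open>S * R'\<close>.\<close>
    have "((S * R') * M) $$ (i, p j) = (\<Sum>l<n. (S * R') $$ (i, l) * M $$ (l, p j))"
      using SM ij pn by (intro index_mult_mat_sum) (auto simp: inverse_mats_def)
    also have "\<dots> = (\<Sum>l<n. if l = j then (S * R') $$ (i, j) * M $$ (j, p j) else 0)"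
      using zero pn ij permutes_inj[OF p(1)] by (intro sum.cong) (auto dest: injD)
    finally have "((S * R') * M) $$ (i, p j) \<noteq> 0"
      using ij nz p(2) by simp
    then have "i = p j"
      using SM ij pn unfolding inverse_mats_def by (auto split: if_splits)
    then show "b j \<le> b' i" using b' by simp
  qed
  ultimately have "filt_eq n (R', S', b) (R, S, b')" by (simp add: filt_eq_def)
  then show ?thesis
    using that[of R S a b'] filt_eq_trans[OF PQ' RS' RS eq'] RS eq by blast
qed

section \<open>The optimal family of filtrations\<close>

text \<open>The bound is 1 rather than strict positivity so that, for fixed bases, the admissible
  weights form a closed set.\<close>

definition feasible ::
    "nat \<Rightarrow> nat \<Rightarrow> ((nat \<Rightarrow> nat) \<Rightarrow> 'k::field) \<Rightarrow> (nat \<Rightarrow> 'k mat) \<Rightarrow> (nat \<Rightarrow> nat \<Rightarrow> real) \<Rightarrow> bool" where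
  "feasible d n v Q w \<longleftrightarrow>
     (\<forall>i\<in>tensor_index d n. tensor_act d n Q v i \<noteq> 0 \<longrightarrow> 1 \<le> (\<Sum>k<d. w k (i k)))"

text \<open>Coordinates in the new bases come from the old ones through \<open>Q' k * P k\<close>. A
  nonzero new coordinate therefore has a contribution from a nonzero old one, along which no weight
  drops. Hence feasibility depends only on the filtrations.\<close>

lemma feasible_mono:
  assumes feas: "feasible d n v Q w"
    and PQ: "\<And>k. k < d \<Longrightarrow> inverse_mats n (P k) (Q k)"
    and Q': "\<And>k. k < d \<Longrightarrow> Q' k \<in> carrier_mat n n"
    and le: "\<And>k. k < d \<Longrightarrow> filt_le n (P k) (w k) (Q' k) (w' k)"
  shows "feasible d n v Q' w'"
  unfolding feasible_def
proof (intro ballI impI)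
  fix i assume i: "i \<in> tensor_index d n" and nz: "tensor_act d n Q' v i \<noteq> 0"
  have c: "P k \<in> carrier_mat n n" "Q k \<in> carrier_mat n n" "P k * Q k = 1\<^sub>m n" if "k < d" for k
    using PQ[OF that] by (auto simp: inverse_mats_def)
  have "tensor_act d n Q' v = tensor_act d n (\<lambda>k. (Q' k * P k) * Q k) v"
    using c Q' by (intro tensor_act_cong)
      (simp add: assoc_mult_mat[of _ n n _ n _ n] right_mult_one_mat[of _ n n])
  also have "\<dots> = tensor_act d n (\<lambda>k. Q' k * P k) (tensor_act d n Q v)"
    using c Q' by (intro tensor_act_mult[symmetric] mult_carrier_mat[of _ n n]) auto
  finally have "(\<Sum>j\<in>tensor_index d n.
      (\<Prod>k<d. (Q' k * P k) $$ (i k, j k)) * tensor_act d n Q v j) \<noteq> 0"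
    using i nz by (simp add: tensor_act_def[of d n "\<lambda>k. Q' k * P k"])
  then obtain j where jI: "j \<in> tensor_index d n" and
      "(\<Prod>k<d. (Q' k * P k) $$ (i k, j k)) * tensor_act d n Q v j \<noteq> 0"
    by (rule sum.not_neutral_contains_not_neutral)
  then have j: "j \<in> tensor_index d n" "tensor_act d n Q v j \<noteq> 0"
      "\<forall>k<d. (Q' k * P k) $$ (i k, j k) \<noteq> 0"
    by auto
  have "1 \<le> (\<Sum>k<d. w k (j k))" using feas j(1,2) by (simp add: feasible_def)
  also have "\<dots> \<le> (\<Sum>k<d. w' k (i k))"
  proof (rule sum_mono)
    fix k assume "k \<in> {..<d}"
    then show "w k (j k) \<le> w' k (i k)"
      using j(3) le[of k] tensor_index_less[OF i] tensor_index_less[OF jI] by (simp add: filt_le_def)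
  qed
  finally show "1 \<le> (\<Sum>k<d. w' k (i k))" .
qed

text \<open>The symmetry of \<open>v\<close> enters the convexity argument here.\<close>

lemma feasible_permute:
  assumes v: "v \<in> symmetric_tensors d n" and s: "\<sigma> permutes {..<d}" and feas: "feasible d n v Q w"
  shows "feasible d n v (Q \<circ> \<sigma>) (w \<circ> \<sigma>)"
  unfolding feasible_def
proof (intro ballI impI)
  fix i assume i: "i \<in> tensor_index d n" and nz: "tensor_act d n (Q \<circ> \<sigma>) v i \<noteq> 0"
  define i' where "i' = i \<circ> inv_into UNIV \<sigma>"
  have i_eq: "i = i' \<circ> \<sigma>" by (simp add: i'_def comp_assoc permutes_inv_o[OF s])
  have "tensor_act d n Q v i' \<noteq> 0" "i' \<in> tensor_index d n"
    using nz i tensor_act_permute[OF v s] comp_permutes_tensor_index[OF s] unfolding i_eq by auto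
  then have "1 \<le> (\<Sum>k<d. w k (i' k))" using feas by (auto simp: feasible_def)
  also have "\<dots> = (\<Sum>k<d. (w \<circ> \<sigma>) k (i k))"
    using sum.permute[OF s, of "\<lambda>k. w k (i' k)"] by (simp add: i_eq o_def)
  finally show "1 \<le> (\<Sum>k<d. (w \<circ> \<sigma>) k (i k))" .
qed

section \<open>Compactness and weights of least norm\<close>

lemma compact_Pi_UNIV:
  fixes S :: "'a \<Rightarrow> 'b::topological_space set"
  assumes "\<And>x. compact (S x)"
  shows "compact {f. \<forall>x. f x \<in> S x}"
proof -
  have "compactin (product_topology (\<lambda>_. euclidean) UNIV) (PiE UNIV S)"
    using assms by (simp add: compactin_PiE)
  then show ?thesis
    by (simp add: euclidean_product_topology PiE_UNIV_domain Pi_def)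
qed

definition weight_norm :: "nat \<Rightarrow> nat \<Rightarrow> (nat \<Rightarrow> nat \<Rightarrow> real) \<Rightarrow> real" where
  "weight_norm d n w = (\<Sum>k<d. \<Sum>l<n. (w k l)\<^sup>2)"

lemma weight_norm_nonneg: "0 \<le> weight_norm d n w"
  by (simp add: weight_norm_def sum_nonneg)

lemma weight_norm_ge:
  assumes "k < d" "l < n"
  shows "(w k l)\<^sup>2 \<le> weight_norm d n w"
proof -
  have "(w k l)\<^sup>2 \<le> (\<Sum>l<n. (w k l)\<^sup>2)"
    using assms by (intro member_le_sum) auto
  also have "\<dots> \<le> weight_norm d n w"
    unfolding weight_norm_def using assms
    by (intro member_le_sum[of k _ "\<lambda>k. \<Sum>l<n. (w k l)\<^sup>2"]) (auto intro: sum_nonneg)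
  finally show ?thesis .
qed

text \<open>The constraints define a closed polyhedron, on which the continuous norm attains its
  minimum once the search is confined to a compact box.\<close>

lemma minimal_weights_exist:
  fixes S :: "(nat \<Rightarrow> nat) set" and W :: "nat \<Rightarrow> nat \<Rightarrow> real"
  assumes S: "S \<subseteq> tensor_index d n"
  defines "C \<equiv> {w :: nat \<Rightarrow> nat \<Rightarrow> real. (\<forall>k<d. (\<Sum>l<n. w k l) = 0) \<and> (\<forall>i\<in>S. 1 \<le> (\<Sum>k<d. w k (i k)))}"
  assumes W: "W \<in> C"
  shows "\<exists>w\<in>C. \<forall>w'\<in>C. weight_norm d n w \<le> weight_norm d n w'"
proof -
  \<comment> \<open>Entries outside \<open>{..<d} \<times> {..<n}\<close> are unconstrained, which
    would spoil compactness; zeroing them affects neither membership in \<open>C\<close> nor the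
    norm.\<close>
  define trunc where "trunc w = (\<lambda>k l. if k < d \<and> l < n then w k l else (0::real))" for w
  have trunc_C: "trunc w \<in> C" if "w \<in> C" for w
  proof -
    have "(\<Sum>k<d. trunc w k (i k)) = (\<Sum>k<d. w k (i k))" if "i \<in> S" for i
      using that S tensor_index_less by (intro sum.cong) (auto simp: trunc_def)
    then show ?thesis using that by (simp add: C_def) (simp add: trunc_def)
  qed
  have norm_trunc: "weight_norm d n (trunc w) = weight_norm d n w" for w
    by (simp add: weight_norm_def trunc_def)
  define c where "c = weight_norm d n W"
  \<comment> \<open>A norm of at most \<open>c\<close> bounds each coordinate by
    \<open>1 + c\<close>, since \<open>c \<le> (1 + c)^2\<close>; this avoids a square root.\<close>
  define B where "B k l = (if k < d \<and> l < n then {-(1 + c)..1 + c} else {0})" for k l :: nat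
  define K where "K = {w. \<forall>k. w k \<in> {f. \<forall>l. f l \<in> B k l}}"
  have "compact K"
    unfolding K_def by (intro compact_Pi_UNIV) (auto simp: B_def)
  have coord: "continuous_on UNIV (\<lambda>w :: nat \<Rightarrow> nat \<Rightarrow> real. w k l)" for k l
    by (rule continuous_on_product_then_coordinatewise[OF
        continuous_on_product_then_coordinatewise[OF continuous_on_id]])
  have "closed C"
    unfolding C_def Ball_def
    by (intro closed_Collect_conj closed_Collect_all closed_Collect_imp open_Collect_const
        closed_Collect_eq closed_Collect_le continuous_intros coord)
  then have "compact (K \<inter> C)" using \<open>compact K\<close> by (rule compact_Int_closed[rotated])
  have c0: "0 \<le> c" by (simp add: c_def weight_norm_nonneg)
  have c1: "c \<le> (1 + c)\<^sup>2" using c0 by (simp add: power2_eq_square algebra_simps)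
  have K: "trunc w \<in> K" if "weight_norm d n w \<le> c" for w
  proof -
    have "w k l \<in> {-(1 + c)..1 + c}" if "k < d" "l < n" for k l
    proof -
      have "(w k l)\<^sup>2 \<le> (1 + c)\<^sup>2"
        using weight_norm_ge[OF that, of w] c1 \<open>weight_norm d n w \<le> c\<close> by linarith
      then have "\<bar>w k l\<bar> \<le> 1 + c" using c0 by (simp add: abs_le_square_iff[symmetric])
      then show ?thesis by (auto simp: abs_le_iff)
    qed
    then show ?thesis by (simp add: K_def B_def trunc_def)
  qed
  have "trunc W \<in> K \<inter> C" using K[of W] trunc_C W by (simp add: c_def)
  moreover have "continuous_on (K \<inter> C) (weight_norm d n)"
    unfolding weight_norm_def
    by (intro continuous_intros continuous_on_subset[OF coord]) auto
  ultimately obtain w where w: "w \<in> K \<inter> C"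
      and min: "\<And>w'. w' \<in> K \<inter> C \<Longrightarrow> weight_norm d n w \<le> weight_norm d n w'"
    using continuous_attains_inf[OF \<open>compact (K \<inter> C)\<close>] by blast
  have "weight_norm d n w \<le> weight_norm d n w'" if "w' \<in> C" for w'
  proof (cases "weight_norm d n w' \<le> c")
    case True
    then show ?thesis using min[of "trunc w'"] K trunc_C that by (simp add: norm_trunc)
  next
    \<comment> \<open>Such weights are already worse than \<open>trunc W\<close>, whose norm is
      \<open>c\<close>.\<close>
    case False
    then show ?thesis using min[OF \<open>trunc W \<in> K \<inter> C\<close>] by (simp add: norm_trunc c_def)
  qed
  then show ?thesis using w by blast
qed

text \<open>The real-weight version of a destabilising one-parameter subgroup of
  \<open>SL(V)^d\<close>; weight sum zero corresponds to determinant 1.\<close>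

definition destabilising ::
    "nat \<Rightarrow> nat \<Rightarrow> ((nat \<Rightarrow> nat) \<Rightarrow> 'k::field) \<Rightarrow> (nat \<Rightarrow> 'k mat) \<Rightarrow> (nat \<Rightarrow> 'k mat) \<Rightarrow>
      (nat \<Rightarrow> nat \<Rightarrow> real) \<Rightarrow> bool" where
  "destabilising d n v P Q w \<longleftrightarrow>
     (\<forall>k<d. inverse_mats n (P k) (Q k) \<and> (\<Sum>l<n. w k l) = 0) \<and> feasible d n v Q w"

text \<open>
  The supports of \<open>v\<close> in the various bases take finitely many values, and the support
  alone determines which weights are feasible.
\<close>

lemma optimal_filtration_exists:
  assumes "destabilising d n v P0 Q0 w0"
  obtains P Q w where "destabilising d n v P Q w"
    "\<And>P' Q' w'. destabilising d n v P' Q' w' \<Longrightarrow> weight_norm d n w \<le> weight_norm d n w'"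
proof -
  define supp where "supp Q = {i \<in> tensor_index d n. tensor_act d n Q v i \<noteq> 0}" for Q
  define C where "C S = {w :: nat \<Rightarrow> nat \<Rightarrow> real.
    (\<forall>k<d. (\<Sum>l<n. w k l) = 0) \<and> (\<forall>i\<in>S. 1 \<le> (\<Sum>k<d. w k (i k)))}" for S
  have in_C: "destabilising d n v P Q w \<longleftrightarrow>
      (\<forall>k<d. inverse_mats n (P k) (Q k)) \<and> w \<in> C (supp Q)" for P Q w
    by (auto simp: destabilising_def feasible_def C_def supp_def)
  define X where "X = {supp Q | P Q w. destabilising d n v P Q w}"
  have "X \<subseteq> Pow (tensor_index d n)" by (auto simp: X_def supp_def)
  then have "finite X" by (rule finite_subset) simp
  have "\<exists>w\<in>C S. \<forall>w'\<in>C S. weight_norm d n w \<le> weight_norm d n w'" if "S \<in> X" for S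
  proof -
    have "S \<subseteq> tensor_index d n" using that by (auto simp: X_def supp_def)
    moreover obtain P Q w where "destabilising d n v P Q w" "S = supp Q"
      using \<open>S \<in> X\<close> unfolding X_def by blast
    then have "w \<in> C S" by (simp add: in_C)
    ultimately show ?thesis unfolding C_def by (rule minimal_weights_exist)
  qed
  then obtain m where m: "\<And>S. S \<in> X \<Longrightarrow> m S \<in> C S"
      "\<And>S w. S \<in> X \<Longrightarrow> w \<in> C S \<Longrightarrow> weight_norm d n (m S) \<le> weight_norm d n w"
    by metis
  have "X \<noteq> {}" using assms by (auto simp: X_def)
  \<comment> \<open>Each support has its own minimiser \<open>m S\<close>; finiteness gives a
    support whose minimum is least.\<close>
  then obtain S where S: "S \<in> X" "\<And>T. T \<in> X \<Longrightarrow> weight_norm d n (m S) \<le> weight_norm d n (m T)"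
    using ex_min_if_finite[of "(\<lambda>S. weight_norm d n (m S)) ` X"] \<open>finite X\<close>
    by (force simp: not_less)
  obtain P Q w where PQ: "destabilising d n v P Q w" "S = supp Q"
    using S(1) by (auto simp: X_def)
  show ?thesis
  proof (rule that)
    show "destabilising d n v P Q (m S)"
      using PQ m(1)[OF S(1)] by (simp add: in_C)
  next
    fix P' Q' w' assume d': "destabilising d n v P' Q' w'"
    then have "supp Q' \<in> X" "w' \<in> C (supp Q')" by (auto simp: X_def in_C)
    then show "weight_norm d n (m S) \<le> weight_norm d n w'"
      using S(2) m(2) order_trans by blast
  qed
qed

text \<open>
  Interchanging the filtrations in positions \<open>j\<close> and \<open>k\<close> gives another optimal family. By
  strict convexity of the norm, its midpoint with the original family, formed in a common
  basis, would be better unless both filtrations agree.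
\<close>

lemma optimal_filtration_symmetric:
  assumes v: "v \<in> symmetric_tensors d n"
    and dst: "destabilising d n v P Q w"
    and opt: "\<And>P' Q' w'. destabilising d n v P' Q' w' \<Longrightarrow> weight_norm d n w \<le> weight_norm d n w'"
    and jk: "j < d" "k < d" "j \<noteq> k"
  shows "filt_eq n (P j, Q j, w j) (P k, Q k, w k)"
proof -
  have PQ: "inverse_mats n (P l) (Q l)" "(\<Sum>i<n. w l i) = 0" if "l < d" for l
    using dst that by (auto simp: destabilising_def)
  have feas: "feasible d n v Q w" using dst by (simp add: destabilising_def)
  obtain R S a b where RS: "inverse_mats n R S"
      and a: "filt_eq n (P j, Q j, w j) (R, S, a)" and b: "filt_eq n (P k, Q k, w k) (R, S, b)"
    using common_basis[OF PQ(1)[OF jk(1)] PQ(1)[OF jk(2)]] .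
  \<comment> \<open>Putting the common basis in both positions makes the exchange affect only the
    weights, so \<open>w1\<close> and \<open>w2\<close> live on the same bases and can be
    averaged.\<close>
  define P1 where "P1 = P(j := R, k := R)"
  define Q1 where "Q1 = Q(j := S, k := S)"
  define w1 where "w1 = w(j := a, k := b)"
  define w2 where "w2 = w(j := b, k := a)"
  define w3 where "w3 = (\<lambda>l i. (w1 l i + w2 l i) / 2)"
  let ?t = "transpose j k"
  have t: "?t permutes {..<d}" using jk by (intro permutes_swap_id) auto
  have PQ1: "inverse_mats n (P1 l) (Q1 l)" if "l < d" for l
    using PQ RS that by (auto simp: P1_def Q1_def)
  have eq1: "filt_eq n (P l, Q l, w l) (P1 l, Q1 l, w1 l)" if "l < d" for l
    using a b PQ(1)[OF that] by (auto simp: P1_def Q1_def w1_def filt_eq_refl)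
  have feas1: "feasible d n v Q1 w1"
    using feas PQ1 eq1 PQ by (intro feasible_mono[of d n v Q w P Q1 w1])
      (auto simp: filt_eq_def inverse_mats_def)
  have "Q1 \<circ> ?t = Q1" "w1 \<circ> ?t = w2"
    using jk by (auto simp: Q1_def w1_def w2_def transpose_def fun_eq_iff)
  then have feas2: "feasible d n v Q1 w2"
    using feasible_permute[OF v t feas1] by simp
  have "feasible d n v Q1 w3"
    unfolding feasible_def
  proof (intro ballI impI)
    fix i assume "i \<in> tensor_index d n" "tensor_act d n Q1 v i \<noteq> 0"
    then have "1 \<le> (\<Sum>k<d. w1 k (i k))" "1 \<le> (\<Sum>k<d. w2 k (i k))"
      using feas1 feas2 by (auto simp: feasible_def)
    then show "1 \<le> (\<Sum>k<d. w3 k (i k))"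
      by (simp add: w3_def sum.distrib flip: sum_divide_distrib)
  qed
  moreover have sum1: "(\<Sum>i<n. w1 l i) = 0" if "l < d" for l
    using filt_eq_sum[OF PQ(1)[OF that] PQ1[OF that] eq1[OF that], of id] PQ(2)[OF that] by simp
  then have "(\<Sum>i<n. w2 l i) = 0" if "l < d" for l
    using that jk \<open>w1 \<circ> ?t = w2\<close> permutes_in_image[OF t, of l] by auto
  then have "(\<Sum>i<n. w3 l i) = 0" if "l < d" for l
    using sum1 that by (simp add: w3_def sum.distrib flip: sum_divide_distrib)
  ultimately have "destabilising d n v P1 Q1 w3"
    using PQ1 by (simp add: destabilising_def)
  then have "weight_norm d n w \<le> weight_norm d n w3" by (rule opt)
  \<comment> \<open>A change of basis within a filtration keeps its weights up to order, hence their
    squares in total.\<close>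
  moreover have "weight_norm d n w = weight_norm d n w1"
    unfolding weight_norm_def 
    by (intro sum.cong[OF refl, of "{..<d}"] filt_eq_sum[OF PQ(1) PQ1 eq1]) auto
  moreover have "weight_norm d n w2 = weight_norm d n w1"
    unfolding weight_norm_def \<open>w1 \<circ> ?t = w2\<close>[symmetric]
    using sum.permute[OF t, of "\<lambda>k. \<Sum>l<n. (w1 k l)\<^sup>2"] by (simp add: o_def)
  \<comment> \<open>Parallelogram identity; as \<open>w1\<close> and \<open>w2\<close> both have the
    minimal norm, it leaves no room for a difference between them.\<close>
  moreover have "weight_norm d n w3 =
      weight_norm d n w1 / 2 + weight_norm d n w2 / 2 - weight_norm d n (\<lambda>l i. w1 l i - w2 l i) / 4"
    unfolding weight_norm_def w3_def sum_divide_distrib sum.distrib[symmetric] sum_subtractf[symmetric]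
    by (intro sum.cong refl) (simp add: power2_eq_square field_simps)
  ultimately have "weight_norm d n (\<lambda>l i. w1 l i - w2 l i) \<le> 0" by simp
  then have "(w1 j i - w2 j i)\<^sup>2 \<le> 0" if "i < n" for i
    using weight_norm_ge[OF jk(1) that, of "\<lambda>l i. w1 l i - w2 l i"] by linarith
  then have "a i = b i" if "i < n" for i
    using that jk by (simp add: w1_def w2_def)
  then have "filt_eq n (P k, Q k, w k) (R, S, a)"
    using b by (auto simp: filt_eq_def filt_le_def)
  then show ?thesis
    using a filt_eq_trans[OF PQ(1)[OF jk(1)] RS PQ(1)[OF jk(2)]] filt_eq_sym by blast
qed

text \<open>Every filtration of an optimal family equals the one in position 0, so
  \<open>feasible_mono\<close> allows replacing them all by it; \<open>d \<ge> 1\<close> provides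
  that position.\<close>

lemma constant_destabilising_exists:
  assumes v: "v \<in> symmetric_tensors d n" and d: "d \<ge> 1" and "destabilising d n v P0 Q0 w0"
  obtains P Q w where "destabilising d n v (\<lambda>_. P) (\<lambda>_. Q) (\<lambda>_. w)"
proof -
  obtain P Q w where dst: "destabilising d n v P Q w"
    "\<And>P' Q' w'. destabilising d n v P' Q' w' \<Longrightarrow> weight_norm d n w \<le> weight_norm d n w'"
    using optimal_filtration_exists[OF assms(3)] by metis
  have PQ: "inverse_mats n (P k) (Q k)" if "k < d" for k
    using dst(1) that by (auto simp: destabilising_def)
  have "filt_eq n (P k, Q k, w k) (P 0, Q 0, w 0)" if "k < d" for k
    using optimal_filtration_symmetric[OF v dst that, where k = 0] d filt_eq_refl[OF PQ[OF that]]
    by (cases "k = 0") auto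
  then have le: "filt_le n (P k) (w k) (Q 0) (w 0)" if "k < d" for k
    using that by (simp add: filt_eq_def)
  have Q0: "Q 0 \<in> carrier_mat n n" using PQ[of 0] d by (simp add: inverse_mats_def)
  have "feasible d n v Q w" using dst(1) by (simp add: destabilising_def)
  then have "feasible d n v (\<lambda>_. Q 0) (\<lambda>_. w 0)"
    by (rule feasible_mono[where Q' = "\<lambda>_. Q 0" and w' = "\<lambda>_. w 0", OF _ PQ Q0 le])
  then have "destabilising d n v (\<lambda>_. P 0) (\<lambda>_. Q 0) (\<lambda>_. w 0)"
    using dst(1) d by (simp add: destabilising_def)
  then show ?thesis by (rule that)
qed

text \<open>Scaling by \<open>d + 1\<close> before taking floors leaves a total of at least
  \<open>(d + 1) - d = 1\<close>, since each of the \<open>d\<close> floors loses at most 1.\<close>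

lemma integral_weights_exist:
  fixes w :: "nat \<Rightarrow> real"
  assumes w: "(\<Sum>l<n. w l) = 0"
  obtains e :: "nat \<Rightarrow> int" where "(\<Sum>l<n. e l) = 0"
    "\<And>i. i \<in> tensor_index d n \<Longrightarrow> 1 \<le> (\<Sum>k<d. w (i k)) \<Longrightarrow> 0 < (\<Sum>k<d. e (i k))"
proof -
  define u where "u l = \<lfloor>(real d + 1) * w l\<rfloor>" for l
  define D where "D = (\<Sum>l<n. u l)"
  \<comment> \<open>The floors sum to \<open>D \<le> 0\<close>; subtracting this defect at index 0
    restores sum zero and can only raise a weight.\<close>
  define e where "e l = u l - (if l = 0 then D else 0)" for l
  have "real_of_int D \<le> (\<Sum>l<n. (real d + 1) * w l)"
    unfolding D_def of_int_sum by (intro sum_mono) (simp add: u_def)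
  then have D: "D \<le> 0" using w by (simp flip: sum_distrib_left)
  show ?thesis
  proof (rule that)
    have "D = 0" if "n = 0" using that by (simp add: D_def)
    then show "(\<Sum>l<n. e l) = 0"
      by (cases "n = 0") (simp_all add: e_def sum_subtractf D_def[symmetric])
  next
    fix i assume i: "1 \<le> (\<Sum>k<d. w (i k))"
    have "(real d + 1) * w l - 1 \<le> e l" for l
    proof -
      have "(real d + 1) * w l - 1 \<le> u l" unfolding u_def by linarith
      moreover have "u l \<le> e l" using D by (simp add: e_def)
      ultimately show ?thesis by linarith
    qed
    then have "(\<Sum>k<d. (real d + 1) * w (i k) - 1) \<le> (\<Sum>k<d. real_of_int (e (i k)))"
      by (intro sum_mono)
    moreover have "(real d + 1) * 1 \<le> (real d + 1) * (\<Sum>k<d. w (i k))"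
      using i by (intro mult_left_mono) auto
    ultimately have "0 < real_of_int (\<Sum>k<d. e (i k))"
      by (simp add: sum_subtractf sum_distrib_left)
    then show "0 < (\<Sum>k<d. e (i k))" by linarith
  qed
qed

section \<open>One-parameter subgroups and weights\<close>

abbreviation (input) const :: "'k::field \<Rightarrow> 'k laurent" where
  "const \<equiv> Poly_Mapping.single 0"

lemma lookup_map_exponents:
  assumes "inj f"
  shows "Poly_Mapping.lookup (map_exponents f p) (f e) = Poly_Mapping.lookup p e"
proof -
  have "Poly_Mapping.lookup (map_exponents f p) (f e) =
      (\<Sum>x\<in>Poly_Mapping.keys p. if x = e then Poly_Mapping.lookup p x else 0)"
    unfolding map_exponents_def lookup_sum lookup_single
    using assms by (intro sum.cong) (auto simp: when_def dest: injD)
  then show ?thesis by (simp add: in_keys_iff)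
qed

lemma lookup_map_exponents_notin:
  "x \<notin> range f \<Longrightarrow> Poly_Mapping.lookup (map_exponents f p) x = 0"
  unfolding map_exponents_def lookup_sum lookup_single
  by (rule sum.neutral) (auto simp: when_def)

lemma lookup_at_st:
  "Poly_Mapping.lookup (at_st p) (e, f) = (if e = f then Poly_Mapping.lookup p e else 0)"
  unfolding at_st_def using lookup_map_exponents[of "\<lambda>e. (e, e)" p e]
  by (auto simp: inj_def intro!: lookup_map_exponents_notin)

text \<open>Distinct pairs of a power of \<open>s\<close> and a power of \<open>t\<close> have
  distinct products, so each coefficient of the product is a single term.\<close>

lemma lookup_at_s_mult_at_t:
  fixes p q :: "'k::field laurent"
  shows "Poly_Mapping.lookup (at_s p * at_t q) (e, f) = Poly_Mapping.lookup p e * Poly_Mapping.lookup q f"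
proof -
  have "Poly_Mapping.lookup (at_s p * at_t q) (e, f) =
      (\<Sum>x\<in>Poly_Mapping.keys p. \<Sum>y\<in>Poly_Mapping.keys q.
        Poly_Mapping.lookup p x * Poly_Mapping.lookup q y when (x, y) = (e, f))"
    unfolding at_s_def at_t_def map_exponents_def sum_product
    by (simp add: mult_single lookup_sum lookup_single)
  also have "\<dots> = (\<Sum>x\<in>Poly_Mapping.keys p. \<Sum>y\<in>Poly_Mapping.keys q.
      if x = e then if y = f then Poly_Mapping.lookup p x * Poly_Mapping.lookup q y else 0 else 0)"
    by (intro sum.cong) (auto simp: when_def)
  also have "\<dots> = (\<Sum>x\<in>Poly_Mapping.keys p.
      if x = e then \<Sum>y\<in>Poly_Mapping.keys q.
        if y = f then Poly_Mapping.lookup p x * Poly_Mapping.lookup q y else 0 else 0)"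
    by (intro sum.cong refl) simp
  also have "\<dots> = Poly_Mapping.lookup p e * Poly_Mapping.lookup q f"
    by (simp add: in_keys_iff)
  finally show ?thesis .
qed

interpretation const_hom: comm_ring_hom "const :: 'k::field \<Rightarrow> 'k laurent"
  by unfold_locales (simp_all add: single_add mult_single)

text \<open>Read from right to left, this expands \<open>p\<close> into monomials, as in the proof
  of \<open>lookup_mult_single\<close>.\<close>

lemma map_exponents_id: "map_exponents (\<lambda>e. e) p = p"
  by (rule poly_mapping_eqI) (rule lookup_map_exponents, simp)

lemma lookup_mult_single:
  fixes p :: "'k::field laurent"
  shows "Poly_Mapping.lookup (p * Poly_Mapping.single s c) e = Poly_Mapping.lookup p (e - s) * c"
proof -
  have "Poly_Mapping.lookup (p * Poly_Mapping.single s c) e =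
      Poly_Mapping.lookup (map_exponents (\<lambda>e. e) p * Poly_Mapping.single s c) e"
    by (simp only: map_exponents_id)
  also have "\<dots> = (\<Sum>x\<in>Poly_Mapping.keys p. Poly_Mapping.lookup p x * c when x + s = e)"
    by (simp add: map_exponents_def sum_distrib_right mult_single lookup_sum lookup_single)
  also have "\<dots> = (\<Sum>x\<in>Poly_Mapping.keys p. if x = e - s then Poly_Mapping.lookup p x * c else 0)"
    by (intro sum.cong) (auto simp: when_def)
  also have "\<dots> = Poly_Mapping.lookup p (e - s) * c"
    by (simp add: in_keys_iff)
  finally show ?thesis .
qed

lemma lookup_const_mult:
  fixes p :: "'k::field laurent"
  shows "Poly_Mapping.lookup (const c * p) e = c * Poly_Mapping.lookup p e"
  using lookup_mult_single[of p 0 c e] by (simp add: mult.commute)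

lemma lookup_laurent_of_poly:
  "Poly_Mapping.lookup (laurent_of_poly p) e = (if 0 \<le> e then coeff p (nat e) else 0)"
proof -
  have "Poly_Mapping.lookup (laurent_of_poly p) e =
      (\<Sum>j\<le>degree p. if j = nat e then (if 0 \<le> e then coeff p j else 0) else 0)"
    unfolding laurent_of_poly_def lookup_sum lookup_single
    by (intro sum.cong) (auto simp: when_def)
  then show ?thesis by (auto simp: coeff_eq_0)
qed

text \<open>Extending over 0 with value 0 means that only positive powers of \<open>t\<close>
  occur.\<close>

lemma laurent_of_poly_vanishing_iff:
  "(\<exists>F. p = laurent_of_poly F \<and> poly F 0 = 0) \<longleftrightarrow> (\<forall>e\<le>0. Poly_Mapping.lookup p e = 0)"
proof
  assume "\<exists>F. p = laurent_of_poly F \<and> poly F 0 = 0"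
  then show "\<forall>e\<le>0. Poly_Mapping.lookup p e = 0"
    by (auto simp: lookup_laurent_of_poly poly_0_coeff_0)
next
  assume p: "\<forall>e\<le>0. Poly_Mapping.lookup p e = 0"
  define F where "F = Abs_poly (\<lambda>j. Poly_Mapping.lookup p (int j))"
  have "finite (int -` Poly_Mapping.keys p)"
    by (intro finite_vimageI) auto
  then have "\<forall>\<^sub>\<infinity>j. Poly_Mapping.lookup p (int j) = 0"
    by (simp add: MOST_iff_cofinite vimage_def in_keys_iff)
  then have F: "coeff F j = Poly_Mapping.lookup p (int j)" for j
    by (simp add: F_def Abs_poly_inverse)
  have "p = laurent_of_poly F"
    by (rule poly_mapping_eqI) (use p in \<open>auto simp: lookup_laurent_of_poly F\<close>)
  then show "\<exists>F. p = laurent_of_poly F \<and> poly F 0 = 0"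
    using p by (intro exI[of _ F]) (simp add: poly_0_coeff_0 F)
qed

lemma has_limit_zero_iff:
  assumes "f \<in> tensors d n"
  shows "has_limit_at_0 d n f (\<lambda>_. 0) \<longleftrightarrow> (\<forall>i. \<forall>e\<le>0. Poly_Mapping.lookup (f i) e = 0)"
proof
  assume "has_limit_at_0 d n f (\<lambda>_. 0)"
  then show "\<forall>i. \<forall>e\<le>0. Poly_Mapping.lookup (f i) e = 0"
    unfolding has_limit_at_0_def using laurent_of_poly_vanishing_iff by metis
next
  assume "\<forall>i. \<forall>e\<le>0. Poly_Mapping.lookup (f i) e = 0"
  then have "\<forall>i. \<exists>F. f i = laurent_of_poly F \<and> poly F 0 = 0"
    by (simp only: laurent_of_poly_vanishing_iff simp_thms)
  from choice[OF this] obtain F where F: "\<And>i. f i = laurent_of_poly (F i)" "\<And>i. poly (F i) 0 = 0"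
    by blast
  define F' where "F' i = (if i \<in> tensor_index d n then F i else 0)" for i
  have "f i = laurent_of_poly (F' i)" for i
    using F(1)[of i] assms by (auto simp: F'_def tensors_def laurent_of_poly_def)
  then show "has_limit_at_0 d n f (\<lambda>_. 0)"
    unfolding has_limit_at_0_def using F(2)
    by (intro exI[of _ F']) (auto simp: tensors_def F'_def)
qed

section \<open>Coefficient matrices as weight projections\<close>

definition coeff_mat :: "int \<Rightarrow> 'k::field laurent mat \<Rightarrow> 'k mat" where
  "coeff_mat e g = map_mat (\<lambda>p. Poly_Mapping.lookup p e) g"

lemma coeff_mat_carrier: "g \<in> carrier_mat n n \<Longrightarrow> coeff_mat e g \<in> carrier_mat n n"
  by (simp add: coeff_mat_def)

lemma coeff_mat_index: "g \<in> carrier_mat n n \<Longrightarrow> i < n \<Longrightarrow> j < n \<Longrightarrow>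
    coeff_mat e g $$ (i, j) = Poly_Mapping.lookup (g $$ (i, j)) e"
  by (auto simp: coeff_mat_def)

lemma coeff_mat_eqI:
  assumes "g \<in> carrier_mat n n" "h \<in> carrier_mat n n" "\<And>e. coeff_mat e g = coeff_mat e h"
  shows "g = h"
proof (rule eq_matI)
  fix i j assume "i < dim_row h" "j < dim_col h"
  then have ij: "i < n" "j < n" using assms by auto
  show "g $$ (i, j) = h $$ (i, j)"
    by (rule poly_mapping_eqI)
      (metis assms(1) assms(2) assms(3) coeff_mat_index ij(1) ij(2))
qed (use assms in auto)

lemma coeff_mat_const_mult:
  assumes "A \<in> carrier_mat n n" "g \<in> carrier_mat n n"
  shows "coeff_mat e (map_mat const A * g) = A * coeff_mat e g"
proof (rule eq_matI)
  fix i j assume "i < dim_row (A * coeff_mat e g)" "j < dim_col (A * coeff_mat e g)"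
  then have ij: "i < n" "j < n" using assms by (auto simp: coeff_mat_def)
  show "coeff_mat e (map_mat const A * g) $$ (i, j) = (A * coeff_mat e g) $$ (i, j)"
    using assms ij
    by (simp add: coeff_mat_index[of _ n] coeff_mat_carrier index_mult_mat_sum[of _ n]
        lookup_sum lookup_const_mult del: index_mult_mat)
qed (use assms in \<open>auto simp: coeff_mat_def\<close>)

lemma carrier_mat_eq_iff:
  assumes "A \<in> carrier_mat n m" "B \<in> carrier_mat n m"
  shows "A = B \<longleftrightarrow> (\<forall>i<n. \<forall>j<m. A $$ (i, j) = B $$ (i, j))"
  using assms by (auto simp: mat_eq_iff)

text \<open>Compare the coefficients of \<open>s^e t^f\<close> in \<open>g(st) = g(s) g(t)\<close>:
  the coefficient matrices are orthogonal idempotents, the projections onto the weight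
  spaces.\<close>

lemma multiplicative_iff_projectors:
  fixes g :: "'k::field laurent mat"
  assumes g: "g \<in> carrier_mat n n"
  shows "map_mat at_st g = map_mat at_s g * map_mat at_t g \<longleftrightarrow>
    (\<forall>e f. coeff_mat e g * coeff_mat f g = (if e = f then coeff_mat e g else 0\<^sub>m n n))"
    (is "?L = ?R \<longleftrightarrow> _")
proof -
  have R: "Poly_Mapping.lookup (?R $$ (i, j)) (e, f) = (coeff_mat e g * coeff_mat f g) $$ (i, j)"
    if "i < n" "j < n" for i j e f
    using that g
    by (simp add: index_mult_mat_sum[of _ n] coeff_mat_index[of _ n] coeff_mat_carrier lookup_sum
        lookup_at_s_mult_at_t del: index_mult_mat)
  have L: "Poly_Mapping.lookup (?L $$ (i, j)) (e, f) =
      (if e = f then coeff_mat e g else 0\<^sub>m n n) $$ (i, j)" if "i < n" "j < n" for i j e f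
    using that g by (auto simp: lookup_at_st coeff_mat_index[of _ n])
  have "?L = ?R \<longleftrightarrow> (\<forall>i<n. \<forall>j<n. ?L $$ (i, j) = ?R $$ (i, j))"
    using g by (auto simp: mat_eq_iff)
  also have "\<dots> \<longleftrightarrow> (\<forall>e f. \<forall>i<n. \<forall>j<n. (coeff_mat e g * coeff_mat f g) $$ (i, j) =
      (if e = f then coeff_mat e g else 0\<^sub>m n n) $$ (i, j))"
    unfolding poly_mapping_eq_iff fun_eq_iff split_paired_All using L R by metis
  also have "\<dots> \<longleftrightarrow> (\<forall>e f. coeff_mat e g * coeff_mat f g = (if e = f then coeff_mat e g else 0\<^sub>m n n))"
  proof (intro iff_allI)
    fix e f
    have "coeff_mat e g * coeff_mat f g \<in> carrier_mat n n"
      "(if e = f then coeff_mat e g else 0\<^sub>m n n) \<in> carrier_mat n n"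
      using coeff_mat_carrier[OF g] by (auto intro: mult_carrier_mat[of _ n n])
    then show "(\<forall>i<n. \<forall>j<n. (coeff_mat e g * coeff_mat f g) $$ (i, j) =
        (if e = f then coeff_mat e g else 0\<^sub>m n n) $$ (i, j)) \<longleftrightarrow>
      coeff_mat e g * coeff_mat f g = (if e = f then coeff_mat e g else 0\<^sub>m n n)"
      using carrier_mat_eq_iff by blast
  qed
  finally show ?thesis .
qed

section \<open>Diagonal one-parameter subgroups and diagonalisation\<close>

definition diag_psg :: "nat \<Rightarrow> (nat \<Rightarrow> int) \<Rightarrow> 'k::field laurent mat" where
  "diag_psg n e = mat n n (\<lambda>(i, j). if i = j then Poly_Mapping.single (e i) 1 else 0)"

lemma diag_psg_carrier [simp]: "diag_psg n e \<in> carrier_mat n n"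
  by (simp add: diag_psg_def)

lemma diag_psg_mult_index:
  assumes "g \<in> carrier_mat n n" "i < n" "j < n"
  shows "(diag_psg n e * g) $$ (i, j) = Poly_Mapping.single (e i) 1 * g $$ (i, j)"
proof -
  have "(diag_psg n e * g) $$ (i, j) =
      (\<Sum>l<n. if l = i then Poly_Mapping.single (e i) 1 * g $$ (i, j) else 0)"
    unfolding index_mult_mat_sum[OF diag_psg_carrier assms]
    using assms by (intro sum.cong refl) (auto simp: diag_psg_def)
  then show ?thesis using assms by simp
qed

lemma prod_single:
  "(\<Prod>l\<in>A. Poly_Mapping.single (e l) (c l)) = Poly_Mapping.single (\<Sum>l\<in>A. e l) (\<Prod>l\<in>A. c l :: 'k::field)"
  for e :: "'a \<Rightarrow> int"
  by (induction A rule: infinite_finite_induct) (simp_all add: mult_single)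

lemma det_diag_psg: "det (diag_psg n e) = Poly_Mapping.single (\<Sum>l<n. e l) (1 :: 'k::field)"
proof -
  have "upper_triangular (diag_psg n e :: 'k laurent mat)"
    by (simp add: upper_triangular_def diag_psg_def)
  then have "det (diag_psg n e :: 'k laurent mat) = prod_list (diag_mat (diag_psg n e))"
    by (rule det_upper_triangular[OF _ diag_psg_carrier])
  also have "\<dots> = (\<Prod>l<n. Poly_Mapping.single (e l) 1)"
    unfolding prod_list_diag_prod by (auto simp: diag_psg_def lessThan_atLeast0 intro!: prod.cong)
  finally show ?thesis by (simp add: prod_single)
qed

lemma inverse_mats_of_det:
  assumes "A \<in> carrier_mat n n" "det A \<noteq> 0"
  obtains B where "inverse_mats n B A"
proof -
  define B where "B = inverse (det A) \<cdot>\<^sub>m adj_mat A"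
  have B: "B \<in> carrier_mat n n" using adj_mat(1)[OF assms(1)] by (simp add: B_def)
  have "A * B = inverse (det A) \<cdot>\<^sub>m (A * adj_mat A)"
    unfolding B_def by (rule mult_smult_distrib[OF assms(1) adj_mat(1)[OF assms(1)]])
  also have "\<dots> = 1\<^sub>m n"
    unfolding adj_mat(2)[OF assms(1)] using assms(2) by (intro eq_matI) auto
  finally have "A * B = 1\<^sub>m n" .
  then show ?thesis
    using assms(1) B mat_mult_left_right_inverse[OF assms(1) B]
    by (intro that[of B]) (simp add: inverse_mats_def)
qed

lemma const_mult:
  "A \<in> carrier_mat n n \<Longrightarrow> B \<in> carrier_mat n n \<Longrightarrow>
    map_mat const (A * B) = map_mat const A * map_mat const (B :: 'k::field mat)"
  by (rule const_hom.mat_hom_mult)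

text \<open>Multilinearity of the determinant in the rows. It serves to find an invertible matrix
  assembled from rows of the weight projections.\<close>

lemma det_sum_rows:
  fixes C :: "'e \<Rightarrow> 'k::field mat"
  assumes "finite E"
  shows "det (mat n n (\<lambda>(i, j). \<Sum>e\<in>E. C e $$ (i, j))) =
    (\<Sum>f\<in>{0..<n} \<rightarrow>\<^sub>E E. det (mat n n (\<lambda>(i, j). C (f i) $$ (i, j))))"
proof -
  let ?G = "mat n n (\<lambda>(i, j). \<Sum>e\<in>E. C e $$ (i, j))"
  have "det ?G = (\<Sum>p | p permutes {0..<n}. signof p * (\<Prod>i = 0..<n. \<Sum>e\<in>E. C e $$ (i, p i)))"
    by (subst det_def'[of _ n]) (auto intro!: sum.cong prod.cong)
  also have "\<dots> = (\<Sum>p | p permutes {0..<n}. \<Sum>f\<in>{0..<n} \<rightarrow>\<^sub>E E.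
      signof p * (\<Prod>i = 0..<n. C (f i) $$ (i, p i)))"
    using assms by (simp add: prod_sum_PiE sum_distrib_left)
  also have "\<dots> = (\<Sum>f\<in>{0..<n} \<rightarrow>\<^sub>E E. det (mat n n (\<lambda>(i, j). C (f i) $$ (i, j))))"
    by (subst sum.swap, subst det_def'[of _ n]) (auto intro!: sum.cong prod.cong)
  finally show ?thesis .
qed

text \<open>The weight projections add up to the identity. Expanding its determinant row by row
  yields an invertible \<open>Q\<close> whose row \<open>i\<close> is row \<open>i\<close> of the
  projection of some weight \<open>f i\<close>; such rows are left eigenvectors of \<open>g\<close>.
  No bases of the weight spaces have to be chosen.\<close>

lemma one_psg_diagonal:
  fixes g :: "'k::field laurent mat"
  assumes "one_psg_SL n g"
  obtains P Q e where "inverse_mats n P Q" "(\<Sum>l<n. e l) = 0"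
    "map_mat const Q * g = diag_psg n e * map_mat const Q"
proof -
  have g: "g \<in> carrier_mat n n" and det_g: "det g = 1"
    and mult: "map_mat at_st g = map_mat at_s g * map_mat at_t g"
    using assms by (auto simp: one_psg_SL_def SL_def)
  let ?C = "\<lambda>e. coeff_mat e g"
  have C: "?C e \<in> carrier_mat n n" for e using g by (rule coeff_mat_carrier)
  have proj: "?C e * ?C f = (if e = f then ?C e else 0\<^sub>m n n)" for e f
    using multiplicative_iff_projectors[OF g] mult by blast
  define E where "E = (\<Union>i<n. \<Union>j<n. Poly_Mapping.keys (g $$ (i, j)))"
  have E: "finite E" by (simp add: E_def)
  have outside: "?C e $$ (i, j) = 0" if "e \<notin> E" "i < n" "j < n" for e i j
    using that g by (auto simp: E_def coeff_mat_index in_keys_iff)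
  \<comment> \<open>\<open>G\<close> is \<open>g\<close> at \<open>t = 1\<close>.\<close>
  define G where "G = mat n n (\<lambda>(i, j). \<Sum>e\<in>E. ?C e $$ (i, j))"
  have Gc: "G \<in> carrier_mat n n" by (simp add: G_def)
  have GC: "G * ?C e = ?C e" for e
  proof (rule eq_matI)
    fix i j assume "i < dim_row (?C e)" "j < dim_col (?C e)"
    then have ij: "i < n" "j < n" using C[of e] by auto
    have "(G * ?C e) $$ (i, j) = (\<Sum>l<n. \<Sum>f\<in>E. ?C f $$ (i, l) * ?C e $$ (l, j))"
      using index_mult_mat_sum[OF Gc C ij] ij by (simp add: G_def sum_distrib_right)
    also have "\<dots> = (\<Sum>f\<in>E. (?C f * ?C e) $$ (i, j))"
      using index_mult_mat_sum[OF C C ij] by (subst sum.swap) simp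
    also have "\<dots> = (\<Sum>f\<in>E. if f = e then ?C e $$ (i, j) else 0)"
      unfolding proj using ij by (intro sum.cong) auto
    also have "\<dots> = ?C e $$ (i, j)" using E outside ij by simp
    finally show "(G * ?C e) $$ (i, j) = ?C e $$ (i, j)" .
  qed (use C[of e] Gc in auto)
  have cG: "map_mat const G \<in> carrier_mat n n" using Gc by simp
  have "map_mat const G * g = g"
    using Gc g GC by (intro coeff_mat_eqI[of _ n]) (auto simp: coeff_mat_const_mult)
  \<comment> \<open>As \<open>det g = 1\<close>, the adjugate inverts \<open>g\<close>, so
    \<open>g\<close> can be cancelled from \<open>G * g = g\<close>.\<close>
  moreover have adj: "g * adj_mat g = 1\<^sub>m n"
    using adj_mat(2)[OF g] det_g by (auto intro!: eq_matI)
  ultimately have "map_mat const G * 1\<^sub>m n = 1\<^sub>m n"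
    using assoc_mult_mat[OF cG g adj_mat(1)[OF g]] by simp
  then have "map_mat const G = 1\<^sub>m n" using cG by simp
  then have "const (det G) = 1" by (metis const_hom.hom_det det_one)
  then have "det G = 1"
    by (metis const_hom.hom_one inj_single injD)
  then have "(\<Sum>f\<in>{0..<n} \<rightarrow>\<^sub>E E. det (mat n n (\<lambda>(i, j). ?C (f i) $$ (i, j)))) \<noteq> 0"
    using det_sum_rows[OF E, of n ?C] unfolding G_def by simp
  then obtain f where f: "det (mat n n (\<lambda>(i, j). ?C (f i) $$ (i, j))) \<noteq> 0"
    by (rule sum.not_neutral_contains_not_neutral)
  define Q where "Q = mat n n (\<lambda>(i, j). ?C (f i) $$ (i, j))"
  have Q: "Q \<in> carrier_mat n n" by (simp add: Q_def)
  have Q_index: "Q $$ (i, j) = ?C (f i) $$ (i, j)" if "i < n" "j < n" for i j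
    using that by (simp add: Q_def)
  obtain P where P: "inverse_mats n P Q"
    using inverse_mats_of_det[OF Q] f by (auto simp: Q_def)
  have cQ: "map_mat const Q \<in> carrier_mat n n" using Q by simp
  have conj: "map_mat const Q * g = diag_psg n f * map_mat const Q"
  proof (rule coeff_mat_eqI[of _ n])
    fix e
    show "coeff_mat e (map_mat const Q * g) = coeff_mat e (diag_psg n f * map_mat const Q)"
      unfolding coeff_mat_const_mult[OF Q g]
    proof (rule eq_matI)
      fix i j assume "i < dim_row (coeff_mat e (diag_psg n f * map_mat const Q))"
        "j < dim_col (coeff_mat e (diag_psg n f * map_mat const Q))"
      then have ij: "i < n" "j < n" using Q by (auto simp: coeff_mat_def diag_psg_def)
      \<comment> \<open>Row \<open>i\<close> of \<open>Q\<close> agrees with that of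
        \<open>?C (f i)\<close>, so orthogonality leaves only the weight
        \<open>e = f i\<close>.\<close>
      have "(Q * ?C e) $$ (i, j) = (?C (f i) * ?C e) $$ (i, j)"
        unfolding index_mult_mat_sum[OF Q C ij] index_mult_mat_sum[OF C C ij]
        using ij by (simp add: Q_index)
      also have "\<dots> = (if f i = e then Q $$ (i, j) else 0)"
        unfolding proj using ij by (auto simp: Q_index)
      also have "\<dots> = coeff_mat e (diag_psg n f * map_mat const Q) $$ (i, j)"
        using ij Q cQ mult_carrier_mat[OF diag_psg_carrier cQ]
        by (subst coeff_mat_index[of _ n])
          (auto simp: diag_psg_mult_index[OF cQ] mult_single lookup_single when_def
            simp del: index_mult_mat)
      finally show "(Q * ?C e) $$ (i, j) = coeff_mat e (diag_psg n f * map_mat const Q) $$ (i, j)" .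
    qed (use Q C[of e] in \<open>auto simp: coeff_mat_def diag_psg_def\<close>)
  qed (rule mult_carrier_mat[OF cQ g] mult_carrier_mat[OF diag_psg_carrier cQ])+
  \<comment> \<open>Determinants compare the nonzero constant \<open>det Q\<close> with its multiple
    by \<open>t\<close> to the total weight, so this weight is 0.\<close>
  then have "const (det Q) * det g = det (diag_psg n f) * const (det Q)"
    using det_mult[OF cQ g] det_mult[OF diag_psg_carrier[of n f] cQ]
    by (metis const_hom.hom_det)
  then have "Poly_Mapping.single 0 (det Q) = Poly_Mapping.single (\<Sum>l<n. f l) (det Q)"
    by (simp add: det_g det_diag_psg mult_single)
  then have "(\<Sum>l<n. f l) = 0"
    using f unfolding Q_def[symmetric] by (metis lookup_single_eq lookup_single_not_eq)
  then show ?thesis using that[OF P _ conj] by blast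
qed

lemma coeff_mat_mult_const:
  assumes "A \<in> carrier_mat n n" "g \<in> carrier_mat n n"
  shows "coeff_mat e (g * map_mat const A) = coeff_mat e g * A"
proof (rule eq_matI)
  fix i j assume "i < dim_row (coeff_mat e g * A)" "j < dim_col (coeff_mat e g * A)"
  then have ij: "i < n" "j < n" using assms by (auto simp: coeff_mat_def)
  show "coeff_mat e (g * map_mat const A) $$ (i, j) = (coeff_mat e g * A) $$ (i, j)"
    using assms ij
    by (simp add: coeff_mat_index[of _ n] coeff_mat_carrier index_mult_mat_sum[of _ n]
        lookup_sum lookup_mult_single del: index_mult_mat)
qed (use assms in \<open>auto simp: coeff_mat_def\<close>)

text \<open>Converse of \<open>one_psg_diagonal\<close>: the coefficient matrices are the conjugates
  \<open>P * (Delta a * Q)\<close> of the diagonal projections, and weight sum zero gives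
  determinant 1.\<close>

lemma one_psg_conj_diag:
  fixes P Q :: "'k::field mat"
  assumes PQ: "inverse_mats n P Q" and e: "(\<Sum>l<n. e l) = 0"
  shows "one_psg_SL n (map_mat const P * (diag_psg n e * map_mat const Q))" (is "one_psg_SL n ?g")
proof -
  have c: "P \<in> carrier_mat n n" "Q \<in> carrier_mat n n" "Q * P = 1\<^sub>m n"
    using PQ by (auto simp: inverse_mats_def)
  let ?D = "diag_psg n e :: 'k laurent mat"
  have cc: "map_mat const P \<in> carrier_mat n n" "map_mat const Q \<in> carrier_mat n n"
    "?D * map_mat const Q \<in> carrier_mat n n" "?g \<in> carrier_mat n n"
    using c by (auto intro!: mult_carrier_mat[of _ n n])
  have "det ?g = const (det P) * (det ?D * const (det Q))"
    using det_mult[OF cc(1,3)] det_mult[OF diag_psg_carrier cc(2)] by simp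
  also have "\<dots> = const (det (Q * P))"
    using det_mult[OF c(2,1)] by (simp add: det_diag_psg e mult_single mult.commute)
  finally have det: "det ?g = 1" using c(3) by simp
  define Delta where "Delta a = coeff_mat a ?D" for a
  have D: "Delta a \<in> carrier_mat n n" for a by (simp add: Delta_def coeff_mat_def)
  have coeff: "coeff_mat a ?g = P * (Delta a * Q)" for a
    using c cc by (simp add: coeff_mat_const_mult coeff_mat_mult_const Delta_def)
  have D_index: "Delta a $$ (i, j) = (if i = j \<and> e i = a then 1 else 0)" if "i < n" "j < n" for a i j
    using that by (auto simp: Delta_def coeff_mat_def diag_psg_def lookup_single when_def)
  have DD: "Delta a * Delta b = (if a = b then Delta a else 0\<^sub>m n n)" for a b
  proof -
    have "(Delta a * Delta b) $$ (i, j) = (if a = b then Delta a else 0\<^sub>m n n) $$ (i, j)"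
      if ij: "i < n" "j < n" for i j
    proof -
      have "(Delta a * Delta b) $$ (i, j) =
          (\<Sum>l<n. if l = i then Delta a $$ (i, i) * Delta b $$ (i, j) else 0)"
        unfolding index_mult_mat_sum[OF D D ij] using ij
        by (intro sum.cong refl) (simp add: D_index)
      also have "\<dots> = Delta a $$ (i, i) * Delta b $$ (i, j)" using ij by simp
      finally show ?thesis using ij by (auto simp: D_index)
    qed
    then show ?thesis
      using D mult_carrier_mat[OF D D] by (subst carrier_mat_eq_iff[of _ n n]) auto
  qed
  have "coeff_mat a ?g * coeff_mat b ?g = (if a = b then coeff_mat a ?g else 0\<^sub>m n n)" for a b
  proof -
    have "coeff_mat a ?g * coeff_mat b ?g = ((P * Delta a) * Q) * (P * (Delta b * Q))"
      unfolding coeff using assoc_mult_mat[OF c(1) D c(2)] by simp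
    also have "\<dots> = (P * Delta a) * (Delta b * Q)"
      by (rule mult_cancel_inner[OF mult_carrier_mat[OF c(1) D] inverse_mats_sym[OF PQ]
            mult_carrier_mat[OF D c(2)]])
    also have "\<dots> = P * (Delta a * (Delta b * Q))"
      by (rule assoc_mult_mat[OF c(1) D mult_carrier_mat[OF D c(2)]])
    also have "\<dots> = P * ((Delta a * Delta b) * Q)"
      using assoc_mult_mat[OF D D c(2)] by simp
    finally show ?thesis using c by (simp add: DD coeff)
  qed
  then have "map_mat at_st ?g = map_mat at_s ?g * map_mat at_t ?g"
    using multiplicative_iff_projectors[OF cc(4)] by blast
  then show ?thesis using det cc(4) by (simp add: one_psg_SL_def SL_def)
qed

section \<open>Limits read off from weights\<close>

lemma tensor_act_const:
  fixes A :: "nat \<Rightarrow> 'k::field mat"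
  assumes A: "\<And>k. k < d \<Longrightarrow> A k \<in> carrier_mat n n" and i: "i \<in> tensor_index d n"
  shows "tensor_act d n (\<lambda>k. map_mat const (A k)) f i =
    (\<Sum>j\<in>tensor_index d n. const (\<Prod>k<d. A k $$ (i k, j k)) * f j)"
proof -
  have "(\<Prod>k<d. map_mat const (A k) $$ (i k, j k)) = const (\<Prod>k<d. A k $$ (i k, j k))"
    if "j \<in> tensor_index d n" for j
  proof -
    have "(\<Prod>k<d. map_mat const (A k) $$ (i k, j k)) = (\<Prod>k<d. const (A k $$ (i k, j k)))"
      using i that A tensor_index_less by (intro prod.cong refl) force
    then show ?thesis by (simp add: prod_single)
  qed
  then show ?thesis using i by (simp add: tensor_act_def)
qed

lemma tensor_act_const_tensor:
  fixes A :: "nat \<Rightarrow> 'k::field mat"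
  assumes "\<And>k. k < d \<Longrightarrow> A k \<in> carrier_mat n n"
  shows "tensor_act d n (\<lambda>k. map_mat const (A k)) (const_tensor v) = const_tensor (tensor_act d n A v)"
proof
  fix i
  show "tensor_act d n (\<lambda>k. map_mat const (A k)) (const_tensor v) i = const_tensor (tensor_act d n A v) i"
  proof (cases "i \<in> tensor_index d n")
    case True
    then show ?thesis
      using tensor_act_const[OF assms True, where f = "const_tensor v"]
      by (simp add: const_tensor_def mult_single tensor_act_def const_hom.hom_sum)
  qed (simp add: const_tensor_def)
qed

text \<open>Constant matrices act on each power of \<open>t\<close> separately, so the absence of a
  given power does not depend on the basis.\<close>

lemma lookup_tensor_act_const_eq_0:
  fixes A :: "nat \<Rightarrow> 'k::field mat"
  assumes "\<And>k. k < d \<Longrightarrow> A k \<in> carrier_mat n n"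
    and "\<And>i. Poly_Mapping.lookup (f i) m = 0"
  shows "Poly_Mapping.lookup (tensor_act d n (\<lambda>k. map_mat const (A k)) f i) m = 0"
proof (cases "i \<in> tensor_index d n")
  case True
  then show ?thesis
    using tensor_act_const[OF assms(1) True, where f = f] assms(2) by (simp add: lookup_sum lookup_const_mult)
qed simp

text \<open>
  In the eigenbasis the coordinate \<open>i\<close> of \<open>v\<close> is multiplied by \<open>t\<close> to the total weight of \<open>i\<close>.
\<close>

lemma limit_zero_iff_weights:
  fixes P Q :: "nat \<Rightarrow> 'k::field mat" and v :: "(nat \<Rightarrow> nat) \<Rightarrow> 'k"
  assumes PQ: "\<And>k. k < d \<Longrightarrow> inverse_mats n (P k) (Q k)"
    and g: "\<And>k. k < d \<Longrightarrow> g k \<in> carrier_mat n n"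
    and conj: "\<And>k. k < d \<Longrightarrow> map_mat const (Q k) * g k = diag_psg n (e k) * map_mat const (Q k)"
  shows "has_limit_at_0 d n (tensor_act d n g (const_tensor v)) (\<lambda>_. 0) \<longleftrightarrow>
    (\<forall>i\<in>tensor_index d n. tensor_act d n Q v i \<noteq> 0 \<longrightarrow> 0 < (\<Sum>k<d. e k (i k)))"
proof -
  have c: "P k \<in> carrier_mat n n" "Q k \<in> carrier_mat n n" "P k * Q k = 1\<^sub>m n" if "k < d" for k
    using PQ[OF that] by (auto simp: inverse_mats_def)
  have cc: "map_mat const (P k) \<in> carrier_mat n n" "map_mat const (Q k) \<in> carrier_mat n n"
    if "k < d" for k using c[OF that] by auto
  let ?P = "\<lambda>k. map_mat const (P k)" and ?Q = "\<lambda>k. map_mat const (Q k)"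
  define f where "f = tensor_act d n g (const_tensor v)"
  define h where "h = tensor_act d n ?Q f"
  have f: "f \<in> tensors d n" by (simp add: f_def tensor_act_tensors)
  have "h = tensor_act d n (\<lambda>k. ?Q k * g k) (const_tensor v)"
    unfolding h_def f_def using cc g by (intro tensor_act_mult) auto
  also have "\<dots> = tensor_act d n (\<lambda>k. diag_psg n (e k) * ?Q k) (const_tensor v)"
    using conj by (rule tensor_act_cong)
  also have "\<dots> = tensor_act d n (\<lambda>k. diag_psg n (e k)) (const_tensor (tensor_act d n Q v))"
    using cc c by (subst tensor_act_mult[symmetric]) (auto simp: tensor_act_const_tensor)
  finally have h_eq: "h = tensor_act d n (\<lambda>k. diag_psg n (e k)) (const_tensor (tensor_act d n Q v))" .
  have h: "h i = Poly_Mapping.single (\<Sum>k<d. e k (i k)) (tensor_act d n Q v i)"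
    if "i \<in> tensor_index d n" for i
    unfolding h_eq
    by (subst tensor_act_diag[OF _ that, where c = "\<lambda>k a. Poly_Mapping.single (e k a) 1"])
      (auto simp: diag_psg_def prod_single const_tensor_def mult_single)
  \<comment> \<open>Undoing the constant base change recovers \<open>f\<close> from
    \<open>h\<close>, so the same powers of \<open>t\<close> occur in both.\<close>
  have "f = tensor_act d n (\<lambda>k. ?P k * ?Q k) f"
  proof (rule tensor_act_one[OF f, symmetric])
    fix k assume "k < d"
    then show "?P k * ?Q k = 1\<^sub>m n"
      using c[of k] const_mult[of "P k" n "Q k"] by (simp add: const_hom.mat_hom_one)
  qed
  also have "\<dots> = tensor_act d n ?P h"
    unfolding h_def using cc by (intro tensor_act_mult[symmetric]) auto
  finally have f_eq: "f = tensor_act d n ?P h" .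
  have "(\<forall>i. Poly_Mapping.lookup (f i) m = 0) \<longleftrightarrow> (\<forall>i. Poly_Mapping.lookup (h i) m = 0)" for m
  proof (intro iffI allI)
    fix i assume "\<forall>i. Poly_Mapping.lookup (f i) m = 0"
    then show "Poly_Mapping.lookup (h i) m = 0"
      unfolding h_def by (intro lookup_tensor_act_const_eq_0[OF c(2)]) auto
  next
    fix i assume "\<forall>i. Poly_Mapping.lookup (h i) m = 0"
    then show "Poly_Mapping.lookup (f i) m = 0"
      by (subst f_eq) (intro lookup_tensor_act_const_eq_0[OF c(1)], auto)
  qed
  then have "has_limit_at_0 d n f (\<lambda>_. 0) \<longleftrightarrow> (\<forall>i. \<forall>m\<le>0. Poly_Mapping.lookup (h i) m = 0)"
    unfolding has_limit_zero_iff[OF f] by blast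
  also have "\<dots> \<longleftrightarrow> (\<forall>i\<in>tensor_index d n. \<forall>m\<le>0. Poly_Mapping.lookup (h i) m = 0)"
  proof -
    have "h i = 0" if "i \<notin> tensor_index d n" for i using that by (simp add: h_def)
    then show ?thesis by (metis lookup_zero)
  qed
  also have "\<dots> \<longleftrightarrow> (\<forall>i\<in>tensor_index d n. tensor_act d n Q v i \<noteq> 0 \<longrightarrow> 0 < (\<Sum>k<d. e k (i k)))"
  proof (rule ball_cong[OF refl])
    fix i assume "i \<in> tensor_index d n"
    then show "(\<forall>m\<le>0. Poly_Mapping.lookup (h i) m = 0) \<longleftrightarrow>
        (tensor_act d n Q v i \<noteq> 0 \<longrightarrow> 0 < (\<Sum>k<d. e k (i k)))"
      by (auto simp: h lookup_single when_def not_less)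
  qed
  finally show ?thesis by (simp add: f_def)
qed

section \<open>From one-parameter subgroups to filtrations and back\<close>

lemma SL_pow_unstable_destabilising:
  assumes "SL_pow_unstable d n v"
  obtains P Q w where "destabilising d n v P Q w"
proof -
  obtain g where g: "\<And>k. k < d \<Longrightarrow> one_psg_SL n (g k)"
    and lim: "has_limit_at_0 d n (tensor_act d n g (const_tensor v)) (\<lambda>_. 0)"
    using assms by (auto simp: SL_pow_unstable_def one_psg_SL_pow_def)
  \<comment> \<open>The guard \<open>k < d\<close> sits inside the existentials so that choice
    yields functions of all \<open>k\<close>.\<close>
  have "\<forall>k. \<exists>P Q e. k < d \<longrightarrow> inverse_mats n P Q \<and> (\<Sum>l<n. e l) = 0 \<and>
      map_mat const Q * g k = diag_psg n e * map_mat const Q"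
    using one_psg_diagonal[OF g] by metis
  then obtain P Q e where PQ: "\<And>k. k < d \<Longrightarrow> inverse_mats n (P k) (Q k)"
    and e: "\<And>k. k < d \<Longrightarrow> (\<Sum>l<n. e k l) = 0"
    and conj: "\<And>k. k < d \<Longrightarrow> map_mat const (Q k) * g k = diag_psg n (e k) * map_mat const (Q k)"
    by metis
  have gc: "g k \<in> carrier_mat n n" if "k < d" for k
    using g[OF that] by (simp add: one_psg_SL_def SL_def)
  have pos: "\<forall>i\<in>tensor_index d n. tensor_act d n Q v i \<noteq> 0 \<longrightarrow> 0 < (\<Sum>k<d. e k (i k))"
    by (rule limit_zero_iff_weights[OF PQ gc conj, THEN iffD1, OF _ _ _ lim])
  have "feasible d n v Q (\<lambda>k l. real_of_int (e k l))"
    unfolding feasible_def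
  proof (intro ballI impI)
    fix i assume "i \<in> tensor_index d n" "tensor_act d n Q v i \<noteq> 0"
    \<comment> \<open>A positive integer is at least 1, the bound in
      \<open>feasible\<close>.\<close>
    then have "1 \<le> (\<Sum>k<d. e k (i k))" using pos by force
    then have "real_of_int 1 \<le> real_of_int (\<Sum>k<d. e k (i k))" by (simp only: of_int_le_iff)
    then show "1 \<le> (\<Sum>k<d. real_of_int (e k (i k)))" by simp
  qed
  moreover have "(\<Sum>l<n. real_of_int (e k l)) = 0" if "k < d" for k
    using e[OF that] by (simp flip: of_int_sum)
  ultimately show ?thesis
    using PQ by (intro that[of P Q "\<lambda>k l. real_of_int (e k l)"]) (simp add: destabilising_def)
qed

lemma constant_destabilising_SL_unstable:
  assumes "destabilising d n v (\<lambda>_. P) (\<lambda>_. Q) (\<lambda>_. w)" and "d \<ge> 1"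
  shows "SL_unstable d n v"
proof -
  have "0 < d" using assms(2) by simp
  then have PQ: "inverse_mats n P Q" and w: "(\<Sum>l<n. w l) = 0"
    and feas: "feasible d n v (\<lambda>_. Q) (\<lambda>_. w)"
    using assms(1) unfolding destabilising_def by blast+
  obtain e where e: "(\<Sum>l<n. e l) = 0"
    "\<And>i. i \<in> tensor_index d n \<Longrightarrow> 1 \<le> (\<Sum>k<d. w (i k)) \<Longrightarrow> 0 < (\<Sum>k<d. e (i k) :: int)"
    using integral_weights_exist[OF w, of d] by blast
  define g where "g = map_mat const P * (diag_psg n e * map_mat const Q)"
  have psg: "one_psg_SL n g" unfolding g_def using PQ e(1) by (rule one_psg_conj_diag)
  have c: "P \<in> carrier_mat n n" "Q \<in> carrier_mat n n" "Q * P = 1\<^sub>m n"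
    using PQ by (auto simp: inverse_mats_def)
  have cc: "map_mat const P \<in> carrier_mat n n" "map_mat const Q \<in> carrier_mat n n"
    "diag_psg n e * map_mat const Q \<in> carrier_mat n n"
    using c by (auto intro!: mult_carrier_mat[of _ n n])
  have "map_mat const Q * g = (map_mat const Q * map_mat const P) * (diag_psg n e * map_mat const Q)"
    unfolding g_def by (rule assoc_mult_mat[OF cc(2,1,3), symmetric])
  also have "map_mat const Q * map_mat const P = 1\<^sub>m n"
    using const_mult[OF c(2,1)] c(3) by (simp add: const_hom.mat_hom_one)
  finally have conj: "map_mat const Q * g = diag_psg n e * map_mat const Q"
    using left_mult_one_mat[OF cc(3)] by simp
  have "g \<in> carrier_mat n n" using psg by (simp add: one_psg_SL_def SL_def)
  then have "has_limit_at_0 d n (tensor_act d n (\<lambda>_. g) (const_tensor v)) (\<lambda>_. 0)"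
    using limit_zero_iff_weights[of d n "\<lambda>_. P" "\<lambda>_. Q" "\<lambda>_. g" "\<lambda>_. e" v] PQ conj e(2) feas
    by (auto simp: feasible_def)
  then show ?thesis using psg by (auto simp: SL_unstable_def)
qed

theorem corollary7:
  fixes n d :: nat and v :: "(nat \<Rightarrow> nat) \<Rightarrow> 'k::field"
  assumes "perfect_field TYPE('k)"
    and "d \<ge> 1"
    and "v \<in> symmetric_tensors d n"
  shows "SL_pow_semistable d n v \<longleftrightarrow> SL_semistable d n v"
proof -
  \<comment> \<open>The constant family \<open>\<lambda>_. g\<close> is the diagonal
    embedding.\<close>
  have "SL_pow_unstable d n v" if "SL_unstable d n v"
    using that by (auto simp: SL_unstable_def SL_pow_unstable_def one_psg_SL_pow_def)
  moreover have "SL_unstable d n v" if "SL_pow_unstable d n v"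
    using that assms(2,3) SL_pow_unstable_destabilising constant_destabilising_exists
      constant_destabilising_SL_unstable by metis
  ultimately show ?thesis by (auto simp: SL_pow_semistable_def SL_semistable_def)
qed

end
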